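(* Let $n\ge 3$, $r\ge 2$ be integers and let $d,c\ge 0$ be integers with $1+d+(n-2)c=r$. Let $G\subset \mathrm{SL}(n,\mathbb{C})$ be the finite cyclic group generated by $\mathrm{diag}(\varepsilon,\varepsilon^{d},\varepsilon^{c},\dots,\varepsilon^{c})$ (with $n-2$ entries $\varepsilon^{c}$), where $\varepsilon$ is a primitive $r$-th root of unity; that is, $\mathbb{C}^n/G$ is the Gorenstein cyclic quotient singularity of type $\frac1r(1,d,c,\dots,c)$. Then $\mathbb{C}^n/G$ has a crepant resolution if and only if every coefficient of the remainder polynomial $\mathcal{R}_*\left(\frac{(1,d,c,\dots,c)}{r}\right)$ has age equal to $1$.
   Context: **Proper fractions and ages.** For $n\ge1$, an $n$-dimensional proper fraction is a symbol $\frac{\mathbf a}{r}=\frac{(a_1,\dots,a_n)}{r}$ with $r$ a positive integer and integers $0\le a_i\le r-1$. Symbols with different numerator or denominator data are not reduced or identified. Its age is $\mathrm{age}\left(\frac{\mathbf a}{r}\right)=\frac1r\sum_{i=1}^n a_i$. It is semi-unimodular if some $a_i=1$. Let $\overline{\mathbb{Q}^{prop}_n}$ be the set of $n$-dimensional proper fractions together with a symbol $\infty$. **Remainder maps.** For $1\le i\le n$ the $i$-th remainder map $R_i:\overline{\mathbb{Q}^{prop}_n}\to\overline{\mathbb{Q}^{prop}_n}$ is given by $R_i(\infty)=\infty$; $R_i\left(\frac{(a_1,\dots,a_n)}{r}\right)=\infty$ if $a_i=0$; and, if $a_i\neq0$, $$R_i\left(\frac{(a_1,\dots,a_n)}{r}\right)=\frac{(\overline{a_1}^{a_i},\dots,\overline{a_{i-1}}^{a_i},\overline{-r}^{a_i},\overline{a_{i+1}}^{a_i},\dots,\overline{a_n}^{a_i})}{a_i},$$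 where $\overline{m}^{k}$ denotes the integer with $0\le\overline{m}^{k}<k$ and $\overline{m}^{k}\equiv m \pmod k$. **Remainder polynomial.** For a semi-unimodular proper fraction $\frac{\mathbf a}{r}$, the remainder polynomial is the formal expression in noncommuting variables $x_1,\dots,x_n$ $$\mathcal{R}_*\left(\frac{\mathbf a}{r}\right)=\frac{\mathbf a}{r}+\sum_{l\ge1}\ \sum_{(i_1,\dots,i_l)\in\{1,\dots,n\}^l}(R_{i_l}\cdots R_{i_2}R_{i_1})\left(\frac{\mathbf a}{r}\right)\cdot x_{i_1}x_{i_2}\cdots x_{i_l},$$ where terms whose coefficient is $\infty$ or $\frac{(0,0,\dots,0)}{1}$ are excluded. Its coefficients are the constant term $\frac{\mathbf a}{r}$ and the coefficients of the remaining (non-excluded) monomials. **Crepant resolutions (toric sense).** Let $N=\mathbb{Z}^n$ with canonical basis $e_1,\dots,e_n$, let $\sigma=\mathbb{R}_{\ge0}e_1+\cdots+\mathbb{R}_{\ge0}e_n$, and let $N'=\mathbb{Z}^n+\mathbb{Z}\cdot\frac1r(1,d,c,\dots,c)\subset\mathbb{R}^n$, so that $N'/N\cong G$ and $\mathbb{C}^n/G$ is the affine toric variety $X(N',\sigma)$. The age of $b=(b_1,\dots,b_n)\in N'$ is $\sum_i b_i$. For a fan $\Sigma$ subdividing $\sigma$, with toric morphism $f:X(N',\Sigma)\to X(N',\sigma)$, one has $K_{X(N',\Sigma)}=f^*K_{X(N',\sigma)}+\sum_{\tau\in\Sigma(1)}(\mathrm{age}(A_\tau)-1)D_\tau$, where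 $A_\tau$ is the primitive generator in $N'$ of the ray $\tau$. A crepant resolution is a smooth $X(N',\Sigma)$ with $f$ crepant, i.e. $K_{X(N',\Sigma)}=f^*K_{X(N',\sigma)}$. Equivalently, it is a subdivision $\Sigma$ of $\sigma$ in which each maximal cone is generated by a $\mathbb{Z}$-basis of $N'$ and all ray generators have age $1$; equivalently, a basic (unimodular with respect to $N'$) triangulation, with vertices in $N'$, of the junior simplex $\mathrm{conv}(e_1,\dots,e_n)$. *)

theory Defs
  imports "HOL-Analysis.Analysis" "HOL-Algebra.Generated_Groups"
begin

text \<open>
  The index set \<open>{1,\<dots>,n}\<close> is a finite type \<open>'n\<close>, so that \<open>n = CARD('n)\<close>.
\<close>

section \<open>Proper fractions, remainder maps, remainder polynomial\<close>

text \<open>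
  The symbol \<open>(a\<^sub>1,\<dots>,a\<^sub>n)/r\<close> is the pair \<open>(a, r)\<close>; the symbol \<open>\<infinity>\<close> is \<open>None\<close>.
\<close>

type_synonym 'n frac = "('n \<Rightarrow> int) \<times> int"

definition proper_fractions :: "'n::finite frac set" where
  "proper_fractions = {(a, r). r > 0 \<and> (\<forall>i. 0 \<le> a i \<and> a i \<le> r - 1)}"

definition proper_fractions_infty :: "'n::finite frac option set" where
  "proper_fractions_infty = insert None (Some ` proper_fractions)"

definition frac_age :: "'n::finite frac \<Rightarrow> rat" where
  "frac_age f = of_int (\<Sum>i\<in>UNIV. fst f i) / of_int (snd f)"

definition semi_unimodular :: "'n::finite frac \<Rightarrow> bool" where
  "semi_unimodular f \<longleftrightarrow> (\<exists>i. fst f i = 1)"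

text \<open>
  For \<open>k > 0\<close> the value \<open>m mod k\<close> on \<^typ>\<open>int\<close> is the representative of \<open>m\<close> in \<open>[0, k)\<close>,
  also for negative \<open>m\<close>.
\<close>

fun remainder :: "'n::finite \<Rightarrow> 'n frac option \<Rightarrow> 'n frac option" where
  "remainder i None = None"
| "remainder i (Some (a, r)) =
     (if a i = 0 then None
      else Some (\<lambda>j. if j = i then (- r) mod a i else a j mod a i, a i))"

lemma remainder_in_proper_fractions_infty:
  assumes "x \<in> proper_fractions_infty"
  shows "remainder i x \<in> proper_fractions_infty"
proof (cases x)
  case None
  then show ?thesis by (simp add: proper_fractions_infty_def)
next
  case (Some f)
  obtain a r where f: "f = (a, r)" by fastforce
  with Some assms have "(a, r) \<in> proper_fractions"
    by (auto simp: proper_fractions_infty_def)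
  then have "0 \<le> a i" by (simp add: proper_fractions_def)
  then show ?thesis
    by (auto simp: Some f proper_fractions_infty_def proper_fractions_def zle_diff1_eq)
qed

text \<open>
  A noncommutative monomial \<open>x\<^bsub>i1\<^esub> \<cdots> x\<^bsub>il\<^esub>\<close> is the list \<open>[i1,\<dots>,il]\<close>, and a formal expression is the
  partial map from monomials to coefficients, undefined at the monomials that do not occur.
  By the definition of \<^const>\<open>fold\<close>, \<open>fold remainder [i1,\<dots>,il] x\<close> is \<open>R\<^bsub>il\<^esub> (\<dots> (R\<^bsub>i1\<^esub> x))\<close>.
\<close>

definition remainder_polynomial :: "'n::finite frac \<Rightarrow> 'n list \<Rightarrow> 'n frac option" where
  "remainder_polynomial f w =
     (if w = [] then Some f
      else if fold remainder w (Some f) = Some (\<lambda>_. 0, 1) then None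
      else fold remainder w (Some f))"

definition coefficients :: "('n list \<Rightarrow> 'n frac option) \<Rightarrow> 'n frac set" where
  "coefficients P = {f. \<exists>w. P w = Some f}"

section \<open>Fans and toric crepant resolutions\<close>

definition rational_polyhedral_cone :: "(real^'n::finite) set \<Rightarrow> (real^'n) set \<Rightarrow> bool" where
  "rational_polyhedral_cone L C \<longleftrightarrow> (\<exists>S. finite S \<and> S \<subseteq> L \<and> C = convex_cone hull S)"

definition strongly_convex :: "(real^'n::finite) set \<Rightarrow> bool" where
  "strongly_convex C \<longleftrightarrow> C \<inter> uminus ` C = {0}"

text \<open>
  The relation \<^const>\<open>face_of\<close> also admits the empty face, which is not a face of a cone in the
  sense of toric geometry.
\<close>

definition fan :: "(real^'n::finite) set \<Rightarrow> (real^'n) set set \<Rightarrow> bool" where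
  "fan L \<Sigma> \<longleftrightarrow> finite \<Sigma> \<and>
     (\<forall>C\<in>\<Sigma>. rational_polyhedral_cone L C \<and> strongly_convex C) \<and>
     (\<forall>C\<in>\<Sigma>. \<forall>F. F face_of C \<and> F \<noteq> {} \<longrightarrow> F \<in> \<Sigma>) \<and>
     (\<forall>C\<in>\<Sigma>. \<forall>D\<in>\<Sigma>. C \<inter> D face_of C \<and> C \<inter> D face_of D)"

definition positive_orthant :: "(real^'n::finite) set" where
  "positive_orthant = {x. \<forall>i. 0 \<le> x $ i}"

definition subdivides :: "(real^'n::finite) set set \<Rightarrow> (real^'n) set \<Rightarrow> bool" where
  "subdivides \<Sigma> \<sigma> \<longleftrightarrow> \<Union>\<Sigma> = \<sigma>"

definition lattice_basis :: "(real^'n::finite) set \<Rightarrow> (real^'n) set \<Rightarrow> bool" where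
  "lattice_basis L B \<longleftrightarrow> independent B \<and> L = {\<Sum>b\<in>B. of_int (k b) *\<^sub>R b | k :: real^'n \<Rightarrow> int. True}"

definition smooth_cone :: "(real^'n::finite) set \<Rightarrow> (real^'n) set \<Rightarrow> bool" where
  "smooth_cone L C \<longleftrightarrow> (\<exists>B S. lattice_basis L B \<and> S \<subseteq> B \<and> C = convex_cone hull S)"

definition smooth_fan :: "(real^'n::finite) set \<Rightarrow> (real^'n) set set \<Rightarrow> bool" where
  "smooth_fan L \<Sigma> \<longleftrightarrow> (\<forall>C\<in>\<Sigma>. smooth_cone L C)"

definition rays :: "(real^'n::finite) set set \<Rightarrow> (real^'n) set set" where
  "rays \<Sigma> = {\<tau>\<in>\<Sigma>. dim \<tau> = 1}"

definition primitive_generator :: "(real^'n::finite) set \<Rightarrow> (real^'n) set \<Rightarrow> real^'n" where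
  "primitive_generator L \<tau> =
     (THE v. v \<in> \<tau> \<inter> L \<and> (\<forall>w\<in>\<tau> \<inter> L. \<exists>k::nat. w = of_nat k *\<^sub>R v))"

definition age :: "real^'n::finite \<Rightarrow> real" where
  "age b = (\<Sum>i\<in>UNIV. b $ i)"

text \<open>
  The coefficient of the prime divisor of the ray \<open>\<tau>\<close> in the relative canonical divisor
  \<open>K\<^bsub>X(L,\<Sigma>)\<^esub> - f\<^sup>* K\<^bsub>X(L,\<sigma>)\<^esub>\<close>, where \<open>\<sigma>\<close> is the positive orthant. The morphism \<open>f\<close> is crepant
  if and only if all of these coefficients vanish.
\<close>

definition discrepancy :: "(real^'n::finite) set \<Rightarrow> (real^'n) set \<Rightarrow> real" where
  "discrepancy L \<tau> = age (primitive_generator L \<tau>) - 1"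

definition crepant_fan :: "(real^'n::finite) set \<Rightarrow> (real^'n) set set \<Rightarrow> bool" where
  "crepant_fan L \<Sigma> \<longleftrightarrow> (\<forall>\<tau>\<in>rays \<Sigma>. discrepancy L \<tau> = 0)"

definition crepant_resolution :: "(real^'n::finite) set \<Rightarrow> (real^'n) set set \<Rightarrow> bool" where
  "crepant_resolution L \<Sigma> \<longleftrightarrow>
     fan L \<Sigma> \<and> subdivides \<Sigma> positive_orthant \<and> smooth_fan L \<Sigma> \<and> crepant_fan L \<Sigma>"

section \<open>Cyclic quotient singularities\<close>

definition SL :: "(complex^'n::finite^'n) monoid" where
  "SL = \<lparr>carrier = {A. det A = 1}, monoid.mult = (**), one = mat 1\<rparr>"

definition diag_matrix :: "('n::finite \<Rightarrow> complex) \<Rightarrow> complex^'n^'n" where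
  "diag_matrix w = (\<chi> i j. if i = j then w i else 0)"

definition primitive_root_of_unity :: "nat \<Rightarrow> complex \<Rightarrow> bool" where
  "primitive_root_of_unity r \<epsilon> \<longleftrightarrow> \<epsilon> ^ r = 1 \<and> (\<forall>k. 0 < k \<and> k < r \<longrightarrow> \<epsilon> ^ k \<noteq> 1)"

definition cyclic_group :: "complex \<Rightarrow> ('n::finite \<Rightarrow> nat) \<Rightarrow> (complex^'n^'n) set" where
  "cyclic_group \<epsilon> a = generate SL {diag_matrix (\<lambda>i. \<epsilon> ^ a i)}"

text \<open>
  For a finite group \<open>G\<close> of diagonal matrices, the quotient \<open>\<complex>\<^sup>n/G\<close> is the affine toric variety of
  the positive orthant and the following lattice, the preimage of \<open>G\<close> under
  \<open>v \<mapsto> diag (exp (2 \<pi> i v\<^sub>1), \<dots>, exp (2 \<pi> i v\<^sub>n))\<close>. It contains \<open>\<int>\<^sup>n\<close> with quotient \<open>G\<close>. The lemma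
  \<open>quotient_lattice_cyclic_group\<close> below shows that for the cyclic group of type \<open>1/r (a\<^sub>1,\<dots>,a\<^sub>n)\<close>
  it is \<open>\<int>\<^sup>n + \<int> \<cdot> 1/r (a\<^sub>1,\<dots>,a\<^sub>n)\<close>, whichever primitive root of unity is chosen.
\<close>

definition quotient_lattice :: "(complex^'n::finite^'n) set \<Rightarrow> (real^'n) set" where
  "quotient_lattice G = {v. diag_matrix (\<lambda>i. exp (2 * of_real pi * \<i> * of_real (v $ i))) \<in> G}"

definition has_crepant_resolution :: "(complex^'n::finite^'n) set \<Rightarrow> bool" where
  "has_crepant_resolution G \<longleftrightarrow> (\<exists>\<Sigma>. crepant_resolution (quotient_lattice G) \<Sigma>)"

text \<open>
  The tuple \<open>(1,d,c,\<dots>,c)\<close>, where \<open>p \<noteq> q\<close> are the first and the second coordinate.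
\<close>

definition weights :: "'n::finite \<Rightarrow> 'n \<Rightarrow> nat \<Rightarrow> nat \<Rightarrow> 'n \<Rightarrow> nat" where
  "weights p q d c = (\<lambda>i. if i = p then 1 else if i = q then d else c)"

definition weight_fraction :: "('n::finite \<Rightarrow> nat) \<Rightarrow> nat \<Rightarrow> 'n frac" where
  "weight_fraction a r = (\<lambda>i. int (a i), int r)"

subsection \<open>Consistency of the definitions\<close>

lemma sum_weights:
  assumes "p \<noteq> (q :: 'n::finite)"
  shows "(\<Sum>i\<in>UNIV. weights p q d c i) = 1 + d + (CARD('n) - 2) * c"
proof -
  have "(\<Sum>i\<in>UNIV. weights p q d c i)
      = weights p q d c p + (weights p q d c q + (\<Sum>i\<in>UNIV - {p} - {q}. weights p q d c i))"
    using assms by (simp add: sum.remove[of UNIV p] sum.remove[of "UNIV - {p}" q])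
  also have "(\<Sum>i\<in>UNIV - {p} - {q}. weights p q d c i) = (\<Sum>i\<in>UNIV - {p} - {q}. c)"
    by (intro sum.cong) (auto simp: weights_def)
  finally show ?thesis
    using assms by (simp add: weights_def card_Diff_singleton_if numeral_2_eq_2)
qed

lemma weight_fraction_proper_semi_unimodular:
  fixes p q :: "'n::finite"
  assumes "CARD('n) \<ge> 3" "r \<ge> 2" "p \<noteq> q" "1 + d + (CARD('n) - 2) * c = r"
  shows "weight_fraction (weights p q d c) r \<in> proper_fractions"
    and "semi_unimodular (weight_fraction (weights p q d c) r)"
proof -
  have "1 * c \<le> (CARD('n) - 2) * c"
    using assms(1) by (intro mult_right_mono) auto
  then have "c < r" "d < r" using assms(4) by linarith+
  then show "weight_fraction (weights p q d c) r \<in> proper_fractions"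
    using assms(2) by (auto simp: weight_fraction_def proper_fractions_def weights_def)
  show "semi_unimodular (weight_fraction (weights p q d c) r)"
    by (auto simp: semi_unimodular_def weight_fraction_def weights_def)
qed

lemma group_SL: "group (SL :: (complex^'n::finite^'n) monoid)"
proof (rule groupI)
  fix A :: "complex^'n^'n" assume "A \<in> carrier SL"
  then have A: "det A = 1" by (simp add: SL_def)
  then obtain B where B: "A ** B = mat 1" "B ** A = mat 1"
    by (metis invertible_def invertible_det_nz zero_neq_one)
  then have "det B * det A = 1" by (metis det_I det_mul)
  with A B show "\<exists>B\<in>carrier SL. B \<otimes>\<^bsub>SL\<^esub> A = \<one>\<^bsub>SL\<^esub>"
    by (auto simp: SL_def)
qed (auto simp: SL_def det_mul matrix_mul_assoc)

lemma diag_matrix_mult: "diag_matrix v ** diag_matrix w = diag_matrix (\<lambda>i. v i * w i)"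
proof -
  have "(\<Sum>k\<in>UNIV. (if i = k then v i else 0) * (if k = j then w k else 0))
      = (\<Sum>k\<in>UNIV. if i = k then (if i = j then v i * w i else 0) else 0)" for i j
    by (intro sum.cong) auto
  then show ?thesis by (simp add: diag_matrix_def matrix_matrix_mult_def vec_eq_iff)
qed

lemma diag_matrix_one: "diag_matrix (\<lambda>i. 1) = mat 1"
  by (simp add: diag_matrix_def mat_def)

lemma det_diag_matrix: "det (diag_matrix w) = (\<Prod>i\<in>UNIV. w i)"
  by (subst det_diagonal) (auto simp: diag_matrix_def)

lemma diag_matrix_eq_iff: "diag_matrix v = diag_matrix w \<longleftrightarrow> v = w"
  by (auto simp: diag_matrix_def vec_eq_iff fun_eq_iff)

lemma diag_matrix_in_SL:
  assumes "primitive_root_of_unity r \<epsilon>" "(\<Sum>i\<in>UNIV. a i) = r"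
  shows "diag_matrix (\<lambda>i. \<epsilon> ^ a i) \<in> carrier SL"
  using assms by (simp add: SL_def det_diag_matrix primitive_root_of_unity_def flip: power_sum)

lemma cyclic_group_eq:
  fixes a :: "'n::finite \<Rightarrow> nat"
  assumes "r > 0" "primitive_root_of_unity r \<epsilon>" "(\<Sum>i\<in>UNIV. a i) = r"
  shows "cyclic_group \<epsilon> a = {diag_matrix (\<lambda>i. \<epsilon> powi (k * int (a i))) | k. True}"
proof -
  interpret SL: group "SL :: (complex^'n^'n) monoid" by (rule group_SL)
  let ?g = "diag_matrix (\<lambda>i. \<epsilon> ^ a i)"
  have g: "?g \<in> carrier SL" by (rule diag_matrix_in_SL[OF assms(2,3)])
  have nz: "\<epsilon> \<noteq> 0" using assms(1,2) by (auto simp: primitive_root_of_unity_def power_0_left)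
  have npow: "?g [^]\<^bsub>SL\<^esub> (k::nat) = diag_matrix (\<lambda>i. \<epsilon> ^ (k * a i))" for k
  proof (induction k)
    case 0
    then show ?case by (simp add: diag_matrix_one) (simp add: SL_def)
  next
    case (Suc k)
    then have "?g [^]\<^bsub>SL\<^esub> Suc k = diag_matrix (\<lambda>i. \<epsilon> ^ (k * a i)) ** ?g"
      by (simp add: SL_def)
    then show ?case by (simp add: diag_matrix_mult power_add mult.commute)
  qed
  have ipow: "?g [^]\<^bsub>SL\<^esub> (k::int) = diag_matrix (\<lambda>i. \<epsilon> powi (k * int (a i)))" for k
  proof (cases "k \<ge> 0")
    case True
    then obtain m where k: "k = int m" using nonneg_int_cases by blast
    have "\<epsilon> powi (int m * int (a i)) = \<epsilon> ^ (m * a i)" for i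
      by (metis of_nat_mult power_int_of_nat)
    then show ?thesis unfolding k int_pow_int npow by simp
  next
    case False
    then obtain m where k: "k = - int m" by (metis nle_le nonneg_int_cases minus_minus neg_0_le_iff_le)
    let ?h = "diag_matrix (\<lambda>i. inverse (\<epsilon> ^ (m * a i)))"
    have m: "?g [^]\<^bsub>SL\<^esub> m \<in> carrier SL" using g by simp
    have h: "?h \<in> carrier SL"
    proof -
      have "det ?h = inverse (det (diag_matrix (\<lambda>i. \<epsilon> ^ (m * a i))))"
        unfolding det_diag_matrix using prod_inversef[of "\<lambda>i. \<epsilon> ^ (m * a i)" UNIV]
        by (simp add: comp_def)
      also have "\<dots> = 1" using m unfolding npow by (simp add: SL_def)
      finally show ?thesis by (simp add: SL_def)
    qed
    have "?h \<otimes>\<^bsub>SL\<^esub> (?g [^]\<^bsub>SL\<^esub> m) = \<one>\<^bsub>SL\<^esub>"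
      unfolding npow using nz by (simp add: SL_def diag_matrix_mult diag_matrix_one)
    then have "inv\<^bsub>SL\<^esub> (?g [^]\<^bsub>SL\<^esub> m) = ?h" using SL.inv_equality m h by blast
    moreover have "\<epsilon> powi (- int m * int (a i)) = inverse (\<epsilon> ^ (m * a i))" for i
      by (metis mult_minus_left of_nat_mult power_int_minus power_int_of_nat)
    ultimately show ?thesis unfolding k SL.int_pow_neg_int[OF g] by simp
  qed
  show ?thesis unfolding cyclic_group_def SL.generate_pow[OF g] ipow by blast
qed

lemma quotient_lattice_cyclic_group:
  fixes a :: "'n::finite \<Rightarrow> nat"
  assumes r: "r > 0" and \<epsilon>: "primitive_root_of_unity r \<epsilon>" and "(\<Sum>i\<in>UNIV. a i) = r"
  shows "quotient_lattice (cyclic_group \<epsilon> a) =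
    {z + of_int k *\<^sub>R (\<chi> i. real (a i) / real r) | z k. \<forall>i. z $ i \<in> \<int>}"
proof -
  define e where "e = (\<lambda>t::real. exp (2 * of_real pi * \<i> * of_real t))"
  have e_fold: "exp (2 * of_real pi * \<i> * of_real t) = e t" for t :: real
    by (simp add: e_def)
  have e_eq: "e s = e t \<longleftrightarrow> s - t \<in> \<int>" for s t
  proof -
    have "e s = e t \<longleftrightarrow> (\<exists>n::int. 2 * of_real pi * \<i> * of_real s
        = 2 * of_real pi * \<i> * of_real t + of_int (2 * n) * pi * \<i>)"
      unfolding e_def by (rule exp_eq)
    also have "\<dots> \<longleftrightarrow> (\<exists>n::int. s = t + of_int n)"
    proof -
      have "2 * of_real pi * \<i> * of_real s = 2 * of_real pi * \<i> * of_real t + of_int (2 * n) * pi * \<i>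
        \<longleftrightarrow> s = t + of_int n" for n :: int
      proof -
        have "2 * of_real pi * \<i> * of_real t + of_int (2 * n) * pi * \<i>
            = 2 * of_real pi * \<i> * of_real (t + of_int n)"
          by (simp add: algebra_simps)
        then show ?thesis by (simp del: of_real_add)
      qed
      then show ?thesis by blast
    qed
    also have "\<dots> \<longleftrightarrow> s - t \<in> \<int>"
      by (metis Ints_cases Ints_of_int add.commute add_diff_cancel_left' diff_add_cancel)
    finally show ?thesis .
  qed
  have e_powi: "e t powi k = e (of_int k * t)" for t k
  proof (cases "k \<ge> 0")
    case True
    then show ?thesis
      by (simp add: e_def power_int_def exp_of_nat_mult[symmetric] algebra_simps)
  next
    case False
    then show ?thesis
      by (simp add: e_def power_int_def exp_of_nat_mult[symmetric] exp_minus[symmetric] algebra_simps)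
  qed
  obtain j where j: "\<epsilon> = e (real j / real r)"
  proof -
    have "\<epsilon> \<in> {z. z ^ r = 1}" using \<epsilon> by (simp add: primitive_root_of_unity_def)
    also have "\<dots> = {exp (2 * of_real pi * \<i> * of_nat j / of_nat r) | j. j < r}"
      by (rule complex_roots_unity) (use r in simp)
    finally show ?thesis using that by (auto simp: e_def)
  qed
  have "coprime j r"
  proof -
    define h where "h = gcd j r"
    have h: "h > 0" using r by (simp add: h_def)
    obtain j' r' where jr: "j = h * j'" "r = h * r'" by (metis dvdE gcd_dvd1 gcd_dvd2 h_def)
    then have r': "r' > 0" using r by (metis gr0I mult_0_right less_irrefl)
    have "\<epsilon> ^ r' = e (of_int (int r') * (real j / real r))"
      unfolding j e_powi[symmetric] by simp
    also have "of_int (int r') * (real j / real r) = real j'"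
      using h r' by (simp add: jr)
    also have "e (real j') = e 0" unfolding e_eq by simp
    finally have "\<epsilon> ^ r' = 1" by (simp add: e_def)
    then have "\<not> r' < r" using \<epsilon> r' by (auto simp: primitive_root_of_unity_def)
    then have "h = 1" using h r' by (simp add: jr(2))
    then show ?thesis by (simp add: h_def coprime_iff_gcd_eq_1)
  qed
  then obtain l :: int and u :: int where lu: "l * int j + u * int r = 1"
    by (metis bezout_int coprime_int_iff coprime_iff_gcd_eq_1)
  have mem: "v \<in> quotient_lattice (cyclic_group \<epsilon> a)
      \<longleftrightarrow> (\<exists>k::int. \<forall>i. v $ i - of_int k * (real j * real (a i) / real r) \<in> \<int>)" for v :: "real^'n"
  proof -
    have pw: "\<epsilon> powi (k * int (a i)) = e (of_int k * (real j * real (a i) / real r))" for k i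
      unfolding j e_powi by (simp add: field_simps)
    show ?thesis
      unfolding quotient_lattice_def cyclic_group_eq[OF assms] e_fold pw
      by (auto simp: diag_matrix_eq_iff fun_eq_iff e_eq)
  qed
  show ?thesis
  proof (intro equalityI subsetI)
    fix v assume "v \<in> quotient_lattice (cyclic_group \<epsilon> a)"
    then obtain k :: int where k: "\<And>i. v $ i - of_int k * (real j * real (a i) / real r) \<in> \<int>"
      unfolding mem by blast
    let ?z = "v - of_int (k * int j) *\<^sub>R (\<chi> i. real (a i) / real r)"
    have "?z $ i \<in> \<int>" for i using k[of i] by (simp add: field_simps)
    moreover have "v = ?z + of_int (k * int j) *\<^sub>R (\<chi> i. real (a i) / real r)" by simp
    ultimately show "v \<in> {z + of_int k *\<^sub>R (\<chi> i. real (a i) / real r) | z k. \<forall>i. z $ i \<in> \<int>}"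
      by blast
  next
    fix v :: "real^'n"
    assume "v \<in> {z + of_int k *\<^sub>R (\<chi> i. real (a i) / real r) | z k. \<forall>i. z $ i \<in> \<int>}"
    then obtain z :: "real^'n" and k :: int where z: "\<And>i. z $ i \<in> \<int>"
      and v: "v = z + of_int k *\<^sub>R (\<chi> i. real (a i) / real r)" by blast
    have "v $ i - of_int (k * l) * (real j * real (a i) / real r) \<in> \<int>" for i
    proof -
      have "real_of_int l * real j + real_of_int u * real r = 1"
        using lu by (metis of_int_1 of_int_add of_int_mult of_int_of_nat_eq)
      then have "1 - real_of_int l * real j = real_of_int u * real r" by simp
      then have *: "real_of_int k * (real (a i) / real r) * (1 - real_of_int l * real j)
          = real_of_int (k * int (a i) * u)" using r by simp
      have "v $ i - of_int (k * l) * (real j * real (a i) / real r)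
          = z $ i + real_of_int k * (real (a i) / real r) * (1 - real_of_int l * real j)"
        using r by (simp add: v field_simps)
      then show ?thesis unfolding * using z by (metis Ints_add Ints_of_int)
    qed
    then show "v \<in> quotient_lattice (cyclic_group \<epsilon> a)" unfolding mem by blast
  qed
qed

end

theory Submission
  imports Defs
begin

text \<open>
  Put \<open>m = n - 2\<close>. Both sides of the equivalence are decided by a division algorithm on the pair
  \<open>(d, c)\<close>, the predicate \<open>age_one_chain\<close>: while \<open>d \<ge> 2\<close>, replace \<open>c\<close> by \<open>c' = c mod d\<close>, demand
  \<open>m c' + 1 \<le> d\<close>, and replace \<open>d\<close> by \<open>d - 1 - m c'\<close>.

  On the side of the remainder polynomial (\<open>descendants_age_one_iff_chain\<close>), the remainder map at
  the entry \<open>1\<close> gives the zero fraction. The remainder map at one of the \<open>m\<close> equal entries annihilates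
  the other equal entries; at most three nonzero entries are left, of which one is \<open>1\<close>. For such
  fractions the sum of the entries is divisible by the denominator and less than twice the
  denominator, so that age one persists. What remains are the powers of the remainder map at the entry \<open>d\<close>,
  and the inequality \<open>m c' + 1 \<le> d\<close> says that such a step produces a fraction of age one, which is
  again of the form \<open>(1, d', c', \<dots>, c') / d\<close>.

  On the geometric side, let \<open>e\<^sub>p\<close>, \<open>e\<^sub>q\<close> be the first two axis vectors and \<open>E\<close> the set of the other \<open>m\<close>.
  The same algorithm produces a chain of lattice points that starts with \<open>e\<^sub>q\<close> and
  \<open>(1, d, c, \<dots>, c) / r\<close>; two consecutive points \<open>a\<close>, \<open>b\<close> form a lattice basis together with \<open>E\<close>, and the
  fraction reached by the remainder map lists the coordinates of the next point with respect to
  \<open>e\<^sub>p\<close>, \<open>b\<close>, \<open>E\<close>.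

  If there is a crepant resolution, every lattice point of the orthant is a sum of lattice points of
  age one (\<open>crepant_resolution_decomposition\<close>). The next point of the chain has so small a second
  coordinate that such a sum consists of one summand off the span of \<open>E\<close> and a multiple of the sum of
  \<open>E\<close>, and comparing ages shows that this multiple is zero (\<open>chain_forced\<close>). So the next point has
  age one and the algorithm succeeds.

  Conversely, if the algorithm succeeds, perform star subdivisions of the orthant at the points of
  the chain, and then at the remaining lattice points of age one in any order. The maximal cones that
  contain \<open>E\<close> are spanned by \<open>E\<close> and two consecutive points of the chain, or by \<open>E\<close>, \<open>e\<^sub>p\<close> and the last
  point, hence by lattice bases (\<open>chain_triangulation\<close>); they contain no further lattice points of
  age one and survive. Any other maximal cone has exactly three generators outside \<open>E\<close>, and these span an
  empty lattice triangle, hence are part of a lattice basis (\<open>short_facet_basis\<close>). The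
  cones of this triangulation form the required fan.
\<close>

section \<open>Remainder polynomials of fractions of type (1,d,c,...,c)\<close>

text \<open>
  The start may be any fraction or \<open>\<infinity>\<close>, so that the property passes to
  remainders one step at a time (\<open>descendants_age_one_step\<close>).
\<close>

definition descendants_age_one :: "'n::finite frac option \<Rightarrow> bool" where
  "descendants_age_one x \<longleftrightarrow>
     (\<forall>w g. fold remainder w x = Some g \<longrightarrow> g = (\<lambda>_. 0, 1) \<or> frac_age g = 1)"

lemma descendants_age_one_step:
  "descendants_age_one x \<longleftrightarrow>
     (\<forall>g. x = Some g \<longrightarrow> g = (\<lambda>_. 0, 1) \<or> frac_age g = 1) \<and>
     (\<forall>i. descendants_age_one (remainder i x))" (is "?l \<longleftrightarrow> ?r")
proof
  assume l: ?l
  then have "fold remainder [] x = Some g \<Longrightarrow> g = (\<lambda>_. 0, 1) \<or> frac_age g = 1" for g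
    unfolding descendants_age_one_def by blast
  moreover have "fold remainder (i # w) x = Some g \<Longrightarrow> g = (\<lambda>_. 0, 1) \<or> frac_age g = 1" for i w g
    using l unfolding descendants_age_one_def by blast
  ultimately show ?r unfolding descendants_age_one_def by simp
next
  assume r: ?r
  show ?l unfolding descendants_age_one_def
  proof (intro allI impI)
    fix w g assume w: "fold remainder w x = Some g"
    show "g = (\<lambda>_. 0, 1) \<or> frac_age g = 1"
    proof (cases w)
      case Nil
      then have "x = Some g" using w by simp
      then show ?thesis using r by blast
    next
      case (Cons i v)
      then have "fold remainder v (remainder i x) = Some g" using w by simp
      then show ?thesis using r unfolding descendants_age_one_def by blast
    qed
  qed
qed

lemma descendants_age_one_None [simp]: "descendants_age_one None"
proof -
  have "fold remainder w None = None" for w :: "'a::finite list" by (induction w) auto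
  then show ?thesis by (simp add: descendants_age_one_def)
qed

lemma descendants_age_one_zero [simp]: "descendants_age_one (Some (\<lambda>_. 0, 1))"
  by (subst descendants_age_one_step) simp

lemma coefficients_age_one_iff:
  assumes "f \<noteq> (\<lambda>_. 0, 1)"
  shows "(\<forall>g\<in>coefficients (remainder_polynomial f). frac_age g = 1) \<longleftrightarrow>
    descendants_age_one (Some f)"
proof -
  have "remainder_polynomial f w = Some g \<longleftrightarrow>
      fold remainder w (Some f) = Some g \<and> g \<noteq> (\<lambda>_. 0, 1)" for w g
    using assms by (auto simp: remainder_polynomial_def)
  then show ?thesis
    unfolding coefficients_def descendants_age_one_def by blast
qed

lemma frac_age_eq_one_iff: "r > 0 \<Longrightarrow> frac_age (a, r) = 1 \<longleftrightarrow> (\<Sum>i\<in>UNIV. a i) = r"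
  by (simp add: frac_age_def) (metis of_int_eq_iff of_int_sum)

lemma remainder_at_one: "a i = 1 \<Longrightarrow> remainder i (Some (a, r)) = Some (\<lambda>_. 0, 1)"
  by (auto simp: fun_eq_iff)

lemma sum_zero_outside_three:
  fixes a :: "'n::finite \<Rightarrow> int"
  assumes "p \<noteq> u" "p \<noteq> v" "u \<noteq> v" "\<And>i. i \<notin> {p, u, v} \<Longrightarrow> a i = 0"
  shows "(\<Sum>i\<in>UNIV. a i) = a p + a u + a v"
proof -
  have "(\<Sum>i\<in>UNIV. a i) = (\<Sum>i\<in>{p, u, v}. a i)"
    by (rule sum.mono_neutral_right) (use assms in auto)
  then show ?thesis using assms by simp
qed

text \<open>
  The sum is a multiple of \<open>k\<close> that lies strictly between \<open>0\<close> and \<open>2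
  k\<close>. For three entries divisibility alone therefore forces age one.
\<close>

lemma neg_mod_add_mod:
  fixes x y k :: int
  assumes "k \<ge> 2" "k dvd 1 + x + y"
  shows "1 + x mod k + y mod k = k"
proof -
  have "k dvd 1 + x mod k + y mod k"
  proof -
    have "1 + x mod k + y mod k = (1 + x + y) - k * (x div k + y div k)"
      by (simp add: minus_mult_div_eq_mod[symmetric] algebra_simps)
    then show ?thesis using assms(2) by (metis dvd_diff dvd_triv_left)
  qed
  then obtain t where t: "1 + x mod k + y mod k = k * t" ..
  have "0 \<le> x mod k" "x mod k < k" "0 \<le> y mod k" "y mod k < k" using assms(1) by auto
  then have "0 < k * t" "k * t < k * 2" using t assms(1) by linarith+
  then have "0 < t" "t < 2" using assms(1) by (simp_all add: zero_less_mult_iff)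
  then show ?thesis using t by simp
qed

text \<open>
  Fractions with three nonzero entries, one of which is \<open>1\<close>, are closed under the
  remainder maps, up to the zero fraction and \<open>\<infinity>\<close>, and the congruence of the
  previous lemma keeps their age at one.
\<close>

lemma descendants_age_one_three:
  fixes a :: "'n::finite \<Rightarrow> int"
  assumes "r \<ge> 2" "a p = 1" "p \<noteq> u" "p \<noteq> v" "u \<noteq> v" "\<And>i. i \<notin> {p, u, v} \<Longrightarrow> a i = 0"
    and "0 \<le> a u" "0 \<le> a v" "1 + a u + a v = r"
  shows "descendants_age_one (Some (a, r))"
  using assms
proof (induction "nat r" arbitrary: a r rule: less_induct)
  case less
  have rec: "descendants_age_one (remainder x (Some (a, r)))"
    if x: "{x, y} = {u, v}" for x y
  proof (cases "a x = 0 \<or> a x = 1")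
    case True
    then show ?thesis by (auto simp: remainder_at_one simp del: remainder.simps(2)) simp
  next
    case False
    with x less.prems have ax: "a x \<ge> 2" "a x < r" "1 + a x + a y = r" "a y \<ge> 0"
      by (auto simp: doubleton_eq_iff)
    let ?b = "\<lambda>j. if j = x then (- r) mod a x else a j mod a x"
    have xy: "x \<noteq> p" "y \<noteq> p" "x \<noteq> y" using x less.prems by (auto simp: doubleton_eq_iff)
    have dvd: "a x dvd 1 + (- r) + a y" 
    proof -
      have "1 + (- r) + a y = - a x" using ax(3) by linarith
      then show ?thesis by simp
    qed
    have sum: "1 + (- r) mod a x + a y mod a x = a x"
      by (rule neg_mod_add_mod) (use ax dvd in auto)
    have "descendants_age_one (Some (?b, a x))"
    proof (rule less.hyps)
      show "nat (a x) < nat r" using ax by simp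
      show "1 + ?b u + ?b v = a x" using sum x xy by (auto simp: doubleton_eq_iff)
      fix i assume "i \<notin> {p, u, v}"
      then show "?b i = 0" using x less.prems by (auto simp: doubleton_eq_iff)
    qed (use ax xy less.prems x in auto)
    then show ?thesis using False by simp
  qed
  show ?case
  proof (subst descendants_age_one_step, intro conjI allI impI)
    fix g assume "Some (a, r) = Some g"
    moreover have "(\<Sum>i\<in>UNIV. a i) = r"
      using sum_zero_outside_three[of p u v a] less.prems by simp
    moreover have "r > 0" using less.prems by simp
    ultimately show "g = (\<lambda>_. 0, 1) \<or> frac_age g = 1"
      using frac_age_eq_one_iff[of r a] by blast
  next
    fix i
    consider "i = p" | "i = u" | "i = v" | "i \<notin> {p, u, v}" by blast
    then show "descendants_age_one (remainder i (Some (a, r)))"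
    proof cases
      case 1
      then show ?thesis using less.prems by (simp add: remainder_at_one del: remainder.simps(2))
    next
      case 2
      then show ?thesis using rec[of u v] by simp
    next
      case 3
      then show ?thesis using rec[of v u] by (simp add: insert_commute)
    next
      case 4
      then show ?thesis using less.prems by simp
    qed
  qed
qed

text \<open>
  The triple \<open>(m, d, c)\<close> stands for the fraction \<open>(1, d, c, \<dots>, c) / (1 + d
  + m c)\<close> with \<open>m\<close> entries \<open>c\<close>. The recursive call is its remainder
  at the entry \<open>d\<close>, and the inequality tests whether that has age one. For \<open>d
  \<le> 1\<close> the remainder is \<open>\<infinity>\<close> or the zero fraction.
\<close>

function age_one_chain :: "nat \<Rightarrow> nat \<Rightarrow> nat \<Rightarrow> bool" where
  "age_one_chain m d c =
     (if d \<le> 1 then True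
      else if m * (c mod d) + 1 \<le> d then age_one_chain m (d - 1 - m * (c mod d)) (c mod d)
      else False)"
  by auto
termination by (relation "Wellfounded.measure (\<lambda>(m, d, c). d)") auto

declare age_one_chain.simps [simp del]

text \<open>
  Only the remainder at \<open>q\<close> can violate age one: the remainder at \<open>p\<close> is
  zero, and the remainder at any other coordinate has nonzero entries at most at \<open>p\<close>,
  \<open>q\<close> and that coordinate.
\<close>

lemma descendants_age_one_iff_chain:
  fixes p q :: "'n::finite"
  assumes m: "m = CARD('n) - 2" "m \<ge> 1" and pq: "p \<noteq> q" and r: "r \<ge> 2" "r = 1 + d + m * c"
  shows "descendants_age_one (Some (weight_fraction (weights p q d c) r)) \<longleftrightarrow> age_one_chain m d c"
  using r
proof (induction d arbitrary: r c rule: less_induct)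
  case (less d)
  define a where "a = (\<lambda>i. int (weights p q d c i))"
  have a: "a p = 1" "a q = int d" "\<And>i. i \<noteq> p \<Longrightarrow> i \<noteq> q \<Longrightarrow> a i = int c"
    using pq by (auto simp: a_def weights_def)
  have r_int: "int r = 1 + int d + int m * int c" using less.prems by simp
  have f: "weight_fraction (weights p q d c) r = (a, int r)"
    by (simp add: weight_fraction_def a_def)
  have "(\<Sum>i\<in>UNIV. a i) = int (\<Sum>i\<in>UNIV. weights p q d c i)" by (simp add: a_def)
  then have "(\<Sum>i\<in>UNIV. a i) = int r"
    using sum_weights[OF pq] m less.prems by simp
  then have age: "frac_age (a, int r) = 1" using frac_age_eq_one_iff[of "int r" a] less.prems(1) by linarith
  have R_c: "descendants_age_one (remainder j (Some (a, int r)))" if j: "j \<noteq> p" "j \<noteq> q" for j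
  proof -
    consider "c = 0" | "c = 1" | "c \<ge> 2" by linarith
    then show ?thesis
    proof cases
      case 1
      then show ?thesis using a(3)[OF j] by simp
    next
      case 2
      then show ?thesis using a(3)[OF j] by (simp add: remainder_at_one del: remainder.simps)
    next
      case 3
      let ?b = "\<lambda>i. if i = j then (- int r) mod int c else a i mod int c"
      have "1 + int d mod int c + (- int r) mod int c = int c"
        by (rule neg_mod_add_mod) (use 3 in \<open>auto simp: r_int\<close>)
      then have "descendants_age_one (Some (?b, int c))"
        by (intro descendants_age_one_three[of "int c" _ p q j]) (use 3 a pq j in auto)
      moreover have "remainder j (Some (a, int r)) = Some (?b, int c)"
        using a(3)[OF j] 3 by (auto simp: fun_eq_iff)
      ultimately show ?thesis by simp
    qed
  qed
  have "descendants_age_one (Some (a, int r)) \<longleftrightarrow>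
      descendants_age_one (remainder q (Some (a, int r)))"
  proof (subst descendants_age_one_step, intro iffI conjI allI impI)
    fix i assume q: "descendants_age_one (remainder q (Some (a, int r)))"
    show "descendants_age_one (remainder i (Some (a, int r)))"
      using q R_c[of i] a(1) remainder_at_one[of a p "int r"]
      by (cases "i = p"; cases "i = q") (auto simp del: remainder.simps)
  qed (use age in auto)
  also have "\<dots> \<longleftrightarrow> age_one_chain m d c"
  proof -
    consider "d = 0" | "d = 1" | "d \<ge> 2" by linarith
    then show ?thesis
    proof cases
      case 1
      then show ?thesis using a(2) by (simp add: age_one_chain.simps)
    next
      case 2
      then show ?thesis using a(2)
        by (simp add: remainder_at_one age_one_chain.simps del: remainder.simps)
    next
      case 3
      define c' where "c' = c mod d"
      define s where "s = (- int r) mod int d"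
      let ?b = "\<lambda>i. if i = q then (- int r) mod int d else a i mod int d"
      have R: "remainder q (Some (a, int r)) = Some (?b, int d)"
        using a(2) 3 by (auto simp: fun_eq_iff)
      have "int d dvd s + int r" unfolding s_def by (simp add: dvd_eq_mod_eq_0 mod_simps)
      moreover have "int d dvd int r - 1 - int m * int c'"
      proof -
        have "int d dvd int c - int c'"
          unfolding c'_def by (simp add: zmod_int flip: minus_mod_eq_mult_div)
        then have "int d dvd int d + int m * (int c - int c')" by simp
        then show ?thesis unfolding r_int by (simp add: algebra_simps)
      qed
      ultimately have "int d dvd s + int r - (int r - 1 - int m * int c')" by (rule dvd_diff)
      then have dvd: "int d dvd 1 + s + int m * int c'" by (simp add: ac_simps)
      have s: "0 \<le> s" "s < int d" using 3 by (auto simp: s_def)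
      have sum_b: "(\<Sum>i\<in>UNIV. ?b i) = 1 + s + int m * int c'"
      proof -
        have "(\<Sum>i\<in>UNIV. ?b i) = ?b p + (?b q + (\<Sum>i\<in>UNIV - {p} - {q}. ?b i))"
          using pq by (simp add: sum.remove[of UNIV p] sum.remove[of "UNIV - {p}" q])
        also have "(\<Sum>i\<in>UNIV - {p} - {q}. ?b i) = (\<Sum>i\<in>UNIV - {p} - {q}. int c')"
          by (intro sum.cong) (auto simp: a c'_def zmod_int)
        also have "\<dots> = int m * int c'"
          using pq m by (simp add: card_Diff_singleton_if numeral_2_eq_2)
        finally show ?thesis using pq a 3 by (simp add: s_def)
      qed
      show ?thesis
      proof (cases "m * c' + 1 \<le> d")
        case True
        then have "int m * int c' + 1 \<le> int d" by (metis of_nat_1 of_nat_add of_nat_le_iff of_nat_mult)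
        moreover obtain t where t: "1 + s + int m * int c' = int d * t" using dvd ..
        ultimately have "0 < int d * t" "int d * t < int d * 2"
          using s by (smt (verit) mult_nonneg_nonneg of_nat_0_le_iff)+
        then have "t = 1" using 3 by (simp add: zero_less_mult_iff)
        then have s_eq: "s = int (d - 1 - m * c')" using t True by (simp add: of_nat_diff)
        have "?b = (\<lambda>i. int (weights p q (d - 1 - m * c') c' i))"
          using s_eq pq 3 by (auto simp: fun_eq_iff weights_def a c'_def s_def zmod_int)
        then have "(?b, int d) = weight_fraction (weights p q (d - 1 - m * c') c') d"
          by (simp add: weight_fraction_def)
        moreover have "descendants_age_one (Some (weight_fraction (weights p q (d - 1 - m * c') c') d))
            \<longleftrightarrow> age_one_chain m (d - 1 - m * c') c'"
          by (rule less.IH) (use 3 True in auto)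
        ultimately show ?thesis unfolding R
          using True 3 by (simp add: age_one_chain.simps[of m d c] c'_def)
      next
        case False
        then have "int d < int m * int c' + 1"
          by (metis not_le of_nat_1 of_nat_add of_nat_le_iff of_nat_mult)
        then have "(\<Sum>i\<in>UNIV. ?b i) \<noteq> int d" using sum_b s by simp
        then have "frac_age (?b, int d) \<noteq> 1" using frac_age_eq_one_iff[of "int d" ?b] 3 by simp
        moreover have "(?b, int d) \<noteq> (\<lambda>_. 0, 1)" using 3 by auto
        ultimately have "\<not> descendants_age_one (Some (?b, int d))"
          by (subst descendants_age_one_step) blast
        then show ?thesis unfolding R
          using False 3 by (simp add: age_one_chain.simps[of m d c] c'_def)
      qed
    qed
  qed
  finally show ?case unfolding f .
qed

section \<open>Simplicial cones and their faces\<close>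

lemma convex_cone_hull_finite:
  fixes S :: "'a::real_vector set"
  assumes "finite S"
  shows "convex_cone hull S = {\<Sum>u\<in>S. l u *\<^sub>R u | l. \<forall>u. 0 \<le> l u}" (is "_ = ?C")
proof
  show "convex_cone hull S \<subseteq> ?C"
  proof (rule hull_minimal)
    show "S \<subseteq> ?C"
    proof
      fix v assume "v \<in> S"
      then have "v = (\<Sum>u\<in>S. (if u = v then 1 else 0) *\<^sub>R u)"
        using assms by (simp add: if_distrib[of "\<lambda>x. x *\<^sub>R _"] cong: if_cong)
      then show "v \<in> ?C" by (intro CollectI exI[of _ "\<lambda>u. if u = v then 1 else 0"]) auto
    qed
    show "convex_cone ?C" unfolding convex_cone_iff
    proof (intro conjI ballI allI impI)
      show "0 \<in> ?C" by (rule CollectI, rule exI[of _ "\<lambda>_. 0"]) auto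
      fix x y assume "x \<in> ?C" "y \<in> ?C"
      then obtain l k where "\<forall>u. 0 \<le> l u" "x = (\<Sum>u\<in>S. l u *\<^sub>R u)"
        "\<forall>u. 0 \<le> k u" "y = (\<Sum>u\<in>S. k u *\<^sub>R u)" by blast
      then have "x + y = (\<Sum>u\<in>S. (l u + k u) *\<^sub>R u)" "\<forall>u. 0 \<le> l u + k u"
        by (simp_all add: scaleR_add_left sum.distrib)
      then show "x + y \<in> ?C" by (intro CollectI exI[of _ "\<lambda>u. l u + k u"] conjI)
    next
      fix x and t :: real assume "x \<in> ?C" "0 \<le> t"
      then obtain l where "\<forall>u. 0 \<le> l u" "x = (\<Sum>u\<in>S. l u *\<^sub>R u)" by blast
      then have "t *\<^sub>R x = (\<Sum>u\<in>S. (t * l u) *\<^sub>R u)" "\<forall>u. 0 \<le> t * l u"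
        using \<open>0 \<le> t\<close> by (simp_all add: scaleR_sum_right)
      then show "t *\<^sub>R x \<in> ?C" by (intro CollectI exI[of _ "\<lambda>u. t * l u"] conjI)
    qed
  qed
  have "(\<Sum>u\<in>T. l u *\<^sub>R u) \<in> convex_cone hull S" if "\<forall>u. 0 \<le> l u" "T \<subseteq> S" for l T
    using finite_subset[OF that(2) assms] that
    by (induction T rule: finite_induct)
      (auto intro!: convex_cone_hull_add convex_cone_hull_mul intro: hull_inc
        simp: convex_cone_hull_contains_0)
  then show "?C \<subseteq> convex_cone hull S" by blast
qed

lemma convex_cone_hull_finiteE:
  fixes S :: "'a::real_vector set"
  assumes "finite S" "x \<in> convex_cone hull S"
  obtains l where "\<And>u. 0 \<le> l u" "x = (\<Sum>u\<in>S. l u *\<^sub>R u)"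
  using assms by (auto simp: convex_cone_hull_finite)

lemma convex_cone_hull_finiteI:
  fixes S :: "'a::real_vector set"
  assumes "finite S" "\<And>u. 0 \<le> l u"
  shows "(\<Sum>u\<in>S. l u *\<^sub>R u) \<in> convex_cone hull S"
  using assms by (auto simp: convex_cone_hull_finite)

lemma independent_coefficients_eq:
  fixes S :: "'a::euclidean_space set"
  assumes "independent S" "(\<Sum>u\<in>S. l u *\<^sub>R u) = (\<Sum>u\<in>S. k u *\<^sub>R u)" "u \<in> S"
  shows "l u = k u"
proof -
  have "(\<Sum>u\<in>S. (l u - k u) *\<^sub>R u) = 0"
    using assms(2) by (simp add: scaleR_diff_left sum_subtractf)
  then have "l u - k u = 0"
    by (rule independentD[OF assms(1) finiteI_independent[OF assms(1)] subset_refl _ assms(3)])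
  then show ?thesis by simp
qed

text \<open>
  A summand, inside the cone of \<open>S\<close>, of a point of the cone of \<open>T\<close> has no coefficient outside
  \<open>T\<close>, because nonnegative coefficients cannot cancel.
\<close>

lemma simplicial_cone_face:
  fixes S :: "'a::euclidean_space set"
  assumes S: "independent S" and T: "T \<subseteq> S"
  shows "convex_cone hull T face_of convex_cone hull S"
proof -
  have fin: "finite S" "finite T" using finiteI_independent[OF S] T finite_subset by blast+
  have summand: "x \<in> convex_cone hull T"
    if x: "x \<in> convex_cone hull S" and y: "y \<in> convex_cone hull S"
      and t: "0 < t" "0 < t'" and xy: "t *\<^sub>R x + t' *\<^sub>R y \<in> convex_cone hull T" for x y t t'
  proof -
    obtain l where l: "\<And>u. 0 \<le> l u" "x = (\<Sum>u\<in>S. l u *\<^sub>R u)"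
      using convex_cone_hull_finiteE[OF fin(1) x] by blast
    obtain k where k: "\<And>u. 0 \<le> k u" "y = (\<Sum>u\<in>S. k u *\<^sub>R u)"
      using convex_cone_hull_finiteE[OF fin(1) y] by blast
    obtain h where h: "\<And>u. 0 \<le> h u" "t *\<^sub>R x + t' *\<^sub>R y = (\<Sum>u\<in>T. h u *\<^sub>R u)"
      using convex_cone_hull_finiteE[OF fin(2) xy] by blast
    have "(\<Sum>u\<in>S. (t * l u + t' * k u) *\<^sub>R u) = t *\<^sub>R x + t' *\<^sub>R y"
      by (simp add: l k scaleR_add_left sum.distrib scaleR_sum_right)
    also have "\<dots> = (\<Sum>u\<in>S. (if u \<in> T then h u else 0) *\<^sub>R u)"
      unfolding h(2) by (rule sum.mono_neutral_cong_left) (use fin T in auto)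
    finally have eq: "t * l u + t' * k u = (if u \<in> T then h u else 0)" if "u \<in> S" for u
      using independent_coefficients_eq[OF S _ that, of "\<lambda>u. t * l u + t' * k u" "\<lambda>u. if u \<in> T then h u else 0"] by simp
    have "l u = 0" if "u \<in> S" "u \<notin> T" for u
    proof -
      have "t * l u + t' * k u = 0" using eq that by simp
      moreover have "0 \<le> t * l u" "0 \<le> t' * k u" using l k t by simp_all
      ultimately have "t * l u = 0" by linarith
      then show ?thesis using t by simp
    qed
    then have "x = (\<Sum>u\<in>T. l u *\<^sub>R u)"
      unfolding l(2) by (intro sum.mono_neutral_right) (use fin T in auto)
    then show ?thesis using convex_cone_hull_finiteI[OF fin(2), of l] l(1) by simp
  qed
  show ?thesis unfolding face_of_def
  proof (intro conjI ballI impI)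
    show "convex_cone hull T \<subseteq> convex_cone hull S" using T by (rule hull_mono)
    show "convex (convex_cone hull T)" by (rule convex_convex_cone_hull)
    fix x y z assume xy: "x \<in> convex_cone hull S" "y \<in> convex_cone hull S"
      and z: "z \<in> convex_cone hull T" "z \<in> open_segment x y"
    then obtain t where t: "0 < t" "t < 1" "z = (1 - t) *\<^sub>R x + t *\<^sub>R y"
      unfolding in_segment by blast
    show "x \<in> convex_cone hull T" using summand[OF xy, of "1 - t" t] z t by simp
    show "y \<in> convex_cone hull T" using summand[OF xy(2,1), of t "1 - t"] z t by (simp add: add.commute)
  qed
qed

lemma dim_simplicial_cone:
  fixes S :: "'a::euclidean_space set"
  assumes "independent S"
  shows "dim (convex_cone hull S) = card S"
proof -
  have "convex_cone hull S \<subseteq> span S"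
  proof (rule hull_minimal)
    show "S \<subseteq> span S" by (rule span_superset)
    show "convex_cone (span S)"
      unfolding convex_cone_iff by (intro conjI ballI allI impI span_add span_scale span_zero)
  qed
  then have "dim (convex_cone hull S) \<le> dim (span S)" by (rule dim_subset)
  moreover have "dim S \<le> dim (convex_cone hull S)" by (rule dim_subset) (rule hull_subset)
  ultimately show ?thesis using assms by (simp add: dim_eq_card_independent)
qed

text \<open>
  The sum \<open>x + y\<close> is the midpoint of \<open>2 x\<close> and \<open>2 y\<close>, and
  faces of cones are closed under scaling.
\<close>

lemma face_of_convex_cone_summand:
  assumes F: "F face_of C" and C: "convex_cone C"
    and xy: "x \<in> C" "y \<in> C" "x + y \<in> F"
  shows "x \<in> F"
proof -
  have conic: "conic F" using face_of_conic[OF _ F] C unfolding convex_cone_def by blast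
  have "2 *\<^sub>R x \<in> F"
  proof (cases "x = y")
    case True
    then show ?thesis using xy by (simp add: scaleR_2)
  next
    case False
    have "2 *\<^sub>R x \<in> C" "2 *\<^sub>R y \<in> C" using C xy by (simp_all add: convex_cone_scaleR)
    moreover have "x + y \<in> open_segment (2 *\<^sub>R x) (2 *\<^sub>R y)"
      unfolding in_segment using False by (auto intro!: exI[of _ "1/2"])
    ultimately show ?thesis using face_ofD[OF F] xy by blast
  qed
  then show ?thesis using conicD[OF conic, of "2 *\<^sub>R x" "1/2"] by simp
qed

text \<open>
  A point of the face is a sum of multiples of the generators, and by the previous lemma each
  summand with positive coefficient lies in the face.
\<close>

lemma face_of_finitely_generated_cone:
  fixes S :: "'a::real_vector set"
  assumes S: "finite S" and F: "F face_of convex_cone hull S" "F \<noteq> {}"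
  shows "F = convex_cone hull (S \<inter> F)"
proof
  let ?C = "convex_cone hull S"
  note C = convex_cone_convex_cone_hull[of S]
  have FC: "F \<subseteq> ?C" using F(1) by (rule face_of_imp_subset)
  have conic: "conic F" using face_of_conic[OF _ F(1)] C unfolding convex_cone_def by blast
  then have cone: "convex_cone F"
    using F(2) face_of_imp_convex[OF F(1)] by (simp add: convex_cone_def)
  show "F \<subseteq> convex_cone hull (S \<inter> F)"
  proof
    fix x assume x: "x \<in> F"
    then have "x \<in> ?C" using FC by blast
    then obtain l where l: "\<And>u. 0 \<le> l u" "x = (\<Sum>u\<in>S. l u *\<^sub>R u)"
      using convex_cone_hull_finiteE[OF S] by blast
    have mem: "(\<Sum>u\<in>T. l u *\<^sub>R u) \<in> ?C" if "T \<subseteq> S" for T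
    proof -
      have "(\<Sum>u\<in>T. l u *\<^sub>R u) \<in> convex_cone hull T"
        using convex_cone_hull_finiteI[OF finite_subset[OF that S], of l] l(1) by simp
      then show ?thesis using hull_mono[OF that, of convex_cone] by blast
    qed
    have "l u = 0" if u: "u \<in> S" "u \<notin> F" for u
    proof (rule ccontr)
      assume "l u \<noteq> 0"
      then have pos: "l u > 0" using l(1) by (metis order_le_less)
      have "x = l u *\<^sub>R u + (\<Sum>u\<in>S - {u}. l u *\<^sub>R u)"
        unfolding l(2) by (rule sum.remove[OF S u(1)])
      then have "l u *\<^sub>R u + (\<Sum>u\<in>S - {u}. l u *\<^sub>R u) \<in> F" using x by simp
      moreover have "l u *\<^sub>R u \<in> ?C" using mem[of "{u}"] u by simp
      ultimately have "l u *\<^sub>R u \<in> F"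
        using mem[of "S - {u}"] face_of_convex_cone_summand[OF F(1) C] by blast
      then show False using conicD[OF conic, of "l u *\<^sub>R u" "1 / l u"] pos u by simp
    qed
    then have "x = (\<Sum>u\<in>S \<inter> F. l u *\<^sub>R u)"
      unfolding l(2) by (intro sum.mono_neutral_right) (use S in auto)
    then show "x \<in> convex_cone hull (S \<inter> F)"
      using convex_cone_hull_finiteI[of "S \<inter> F" l] S l(1) by simp
  qed
  show "convex_cone hull (S \<inter> F) \<subseteq> F" using cone by (intro hull_minimal) auto
qed

section \<open>Crepant resolutions decompose lattice points into junior points\<close>

text \<open>
  The lattice points of the junior simplex, the convex hull of the axis vectors.
\<close>

definition junior_points :: "(real^'n::finite) set \<Rightarrow> (real^'n) set" where
  "junior_points L = {u \<in> L. (\<forall>i. 0 \<le> u $ i) \<and> age u = 1}"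

lemma lattice_basis_subset:
  fixes L :: "(real^'n::finite) set"
  assumes B: "lattice_basis L B"
  shows "B \<subseteq> L"
proof
  fix s assume s: "s \<in> B"
  have fin: "finite B" using B finiteI_independent by (auto simp: lattice_basis_def)
  have "s = (\<Sum>b\<in>B. of_int (if b = s then 1 else 0) *\<^sub>R b)"
    using fin s by (simp add: if_distrib[of "\<lambda>x. of_int x *\<^sub>R _"] cong: if_cong)
  then have "s \<in> {\<Sum>b\<in>B. of_int (k b) *\<^sub>R b | k :: real^'n \<Rightarrow> int. True}"
    by (intro CollectI exI[of _ "\<lambda>b. if b = s then 1 else 0"]) simp
  then show "s \<in> L" using B by (simp add: lattice_basis_def)
qed

lemma primitive_generator_basis_vector:
  fixes L :: "(real^'n::finite) set"
  assumes B: "lattice_basis L B" and s: "s \<in> B"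
  shows "primitive_generator L (convex_cone hull {s}) = s"
proof -
  have ind: "independent B" and L: "L = {\<Sum>b\<in>B. of_int (k b) *\<^sub>R b | k. True}"
    using B by (auto simp: lattice_basis_def)
  have fin: "finite B" using ind by (rule finiteI_independent)
  have nz: "s \<noteq> 0" using ind s dependent_zero by blast
  have ray: "convex_cone hull {s} = {t *\<^sub>R s | t. 0 \<le> t}"
  proof -
    have "convex_cone hull {s} = {l s *\<^sub>R s | l. \<forall>u. 0 \<le> l u}"
      by (simp add: convex_cone_hull_finite)
    also have "\<dots> = {t *\<^sub>R s | t. 0 \<le> t}"
    proof (intro equalityI subsetI)
      fix x assume "x \<in> {t *\<^sub>R s | t. 0 \<le> t}"
      then obtain t where "x = t *\<^sub>R s" "0 \<le> t" by blast
      then show "x \<in> {l s *\<^sub>R s | l. \<forall>u. 0 \<le> l u}"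
        by (intro CollectI exI[of _ "\<lambda>_. t"]) simp
    qed auto
    finally show ?thesis .
  qed
  have mult: "\<exists>k::nat. w = of_nat k *\<^sub>R s" if w: "w \<in> convex_cone hull {s} \<inter> L" for w
  proof -
    obtain t where t: "w = t *\<^sub>R s" "0 \<le> t" using w ray by blast
    obtain k :: "real^'n \<Rightarrow> int" where k: "w = (\<Sum>b\<in>B. of_int (k b) *\<^sub>R b)" using w L by blast
    have "(\<Sum>b\<in>B. (if b = s then t else 0) *\<^sub>R b) = t *\<^sub>R s"
      using fin s by (simp add: if_distrib[of "\<lambda>x. x *\<^sub>R _"] cong: if_cong)
    then have "(\<Sum>b\<in>B. of_int (k b) *\<^sub>R b) = (\<Sum>b\<in>B. (if b = s then t else 0) *\<^sub>R b)"
      using k t(1) by metis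
    from independent_coefficients_eq[OF ind this s] have ks: "of_int (k s) = t" by simp
    then have "k s \<ge> 0" using t(2) by (metis of_int_0_le_iff)
    then have "of_nat (nat (k s)) = t" using ks by (metis of_int_of_nat_eq int_nat_eq)
    then show ?thesis using t(1) by metis
  qed
  have sL: "s \<in> convex_cone hull {s} \<inter> L"
    using lattice_basis_subset[OF B] s by (auto simp: hull_inc)
  show ?thesis unfolding primitive_generator_def
  proof (rule the_equality)
    show "s \<in> convex_cone hull {s} \<inter> L \<and>
        (\<forall>w\<in>convex_cone hull {s} \<inter> L. \<exists>k::nat. w = of_nat k *\<^sub>R s)"
      using sL mult by blast
    fix v assume v: "v \<in> convex_cone hull {s} \<inter> L \<and>
        (\<forall>w\<in>convex_cone hull {s} \<inter> L. \<exists>k::nat. w = of_nat k *\<^sub>R v)"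
    then obtain k :: nat where k: "s = of_nat k *\<^sub>R v" using sL by meson
    obtain l :: nat where l: "v = of_nat l *\<^sub>R s" using v mult by meson
    have "(1::real) *\<^sub>R s = of_nat (k * l) *\<^sub>R s"
      using k unfolding l by (metis of_nat_mult scaleR_one scaleR_scaleR)
    then have "real (k * l) = 1" using nz by (metis scaleR_cancel_right)
    then have "l = 1" by (metis nat_mult_eq_1_iff of_nat_eq_1_iff)
    then show "v = s" using l by simp
  qed
qed

text \<open>
  A lattice point of the orthant lies in a smooth cone of the fan, where it is a nonnegative
  integral combination of the generators. These generate rays of the fan, so they have age one.
\<close>

lemma crepant_resolution_decomposition:
  fixes L :: "(real^'n::finite) set"
  assumes cr: "crepant_resolution L \<Sigma>" and x: "x \<in> L" "\<And>i. 0 \<le> x $ i"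
  obtains S k where "finite S" "S \<subseteq> junior_points L" "x = (\<Sum>u\<in>S. of_nat (k u) *\<^sub>R u)"
proof -
  have "x \<in> \<Union>\<Sigma>" using cr x(2) by (auto simp: crepant_resolution_def subdivides_def positive_orthant_def)
  then obtain C where C: "C \<in> \<Sigma>" "x \<in> C" by blast
  then obtain B S where B: "lattice_basis L B" and SB: "S \<subseteq> B" and CS: "C = convex_cone hull S"
    using cr unfolding crepant_resolution_def smooth_fan_def smooth_cone_def by blast
  have ind: "independent B" and L: "L = {\<Sum>b\<in>B. of_int (k b) *\<^sub>R b | k. True}"
    using B by (auto simp: lattice_basis_def)
  have fin: "finite B" "finite S" using ind finiteI_independent SB finite_subset by blast+
  have indS: "independent S" using ind SB independent_mono by blast
  obtain l where l: "\<And>u. 0 \<le> l u" "x = (\<Sum>u\<in>S. l u *\<^sub>R u)"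
    using convex_cone_hull_finiteE[OF fin(2)] C(2) unfolding CS by blast
  obtain k :: "real^'n \<Rightarrow> int" where k: "x = (\<Sum>b\<in>B. of_int (k b) *\<^sub>R b)" using x L by blast
  have "x = (\<Sum>b\<in>B. (if b \<in> S then l b else 0) *\<^sub>R b)"
    unfolding l(2) by (rule sum.mono_neutral_cong_left) (use fin SB in auto)
  with k have eq: "(\<Sum>b\<in>B. of_int (k b) *\<^sub>R b) = (\<Sum>b\<in>B. (if b \<in> S then l b else 0) *\<^sub>R b)"
    by (rule trans[OF sym])
  have kl: "of_int (k b) = l b" if "b \<in> S" for b
    using independent_coefficients_eq[OF ind eq, of b] that SB by auto
  have x_eq: "x = (\<Sum>u\<in>S. of_nat (nat (k u)) *\<^sub>R u)"
    unfolding l(2)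
  proof (rule sum.cong)
    fix u assume "u \<in> S"
    then have "of_int (k u) = l u" using kl by simp
    moreover from this have "k u \<ge> 0" using l(1) by (metis of_int_0_le_iff)
    ultimately show "l u *\<^sub>R u = of_nat (nat (k u)) *\<^sub>R u" by simp
  qed simp
  have "S \<subseteq> junior_points L"
  proof
    fix s assume s: "s \<in> S"
    let ?R = "convex_cone hull {s}"
    have "?R face_of C" unfolding CS by (rule simplicial_cone_face[OF indS]) (use s in auto)
    then have R: "?R \<in> \<Sigma>"
      using cr C(1) convex_cone_hull_nonempty[of "{s}"]
      unfolding crepant_resolution_def fan_def by blast
    have ind_s: "independent {s}" using indS s independent_mono by blast
    then have "?R \<in> rays \<Sigma>" using R dim_simplicial_cone[OF ind_s] by (simp add: rays_def)
    then have "discrepancy L ?R = 0" using cr by (auto simp: crepant_resolution_def crepant_fan_def)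
    then have "age s = 1"
      using primitive_generator_basis_vector[OF B] s SB by (auto simp: discrepancy_def)
    moreover have "s \<in> ?R" by (simp add: hull_inc)
    then have "s \<in> positive_orthant"
      using R cr by (auto simp: crepant_resolution_def subdivides_def)
    moreover have "s \<in> L"
      using lattice_basis_subset[OF B] s SB by blast
    ultimately show "s \<in> junior_points L" by (simp add: junior_points_def positive_orthant_def)
  qed
  then show ?thesis by (rule that[OF fin(2) _ x_eq])
qed

section \<open>The chain of lattice points\<close>

lemma age_add: "age (x + y) = age x + age y"
  by (simp add: age_def sum.distrib)

lemma age_diff: "age (x - y) = age x - age y"
  by (simp add: age_def sum_subtractf)

lemma age_scaleR: "age (t *\<^sub>R x) = t * age x"
  by (simp add: age_def sum_distrib_left)

lemma age_sum: "age (\<Sum>u\<in>S. l u *\<^sub>R u) = (\<Sum>u\<in>S. l u * age u)"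
  by (induction S rule: infinite_finite_induct) (auto simp: age_add age_scaleR, auto simp: age_def)

lemma age_axis: "age (axis i 1) = 1"
  by (simp add: age_def axis_def)

text \<open>
  The properties of the lattice of type \<open>1/r (1, d, c, \<dots>, c)\<close> that the geometry
  uses: it contains the standard lattice, ages are integral, and all coordinates other than
  \<open>p\<close> and \<open>q\<close> agree modulo integers.
\<close>

locale two_coordinate_lattice =
  fixes p q :: "'n::finite" and L :: "(real^'n) set"
  assumes card: "CARD('n) \<ge> 3"
    and pq: "p \<noteq> q"
    and diff_in: "\<And>x y. x \<in> L \<Longrightarrow> y \<in> L \<Longrightarrow> x - y \<in> L"
    and axis_in: "\<And>i. axis i 1 \<in> L"
    and age_Ints: "\<And>x. x \<in> L \<Longrightarrow> age x \<in> \<int>"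
    and tail_diff_Ints: "\<And>x j k. x \<in> L \<Longrightarrow> j \<notin> {p, q} \<Longrightarrow> k \<notin> {p, q} \<Longrightarrow> x $ j - x $ k \<in> \<int>"
begin

definition I :: "'n set" where "I = - {p, q}"

definition m :: nat where "m = CARD('n) - 2"

definition tail :: "('n \<Rightarrow> int) \<Rightarrow> real^'n" where
  "tail k = (\<chi> i. if i \<in> I then of_int (k i) else 0)"

abbreviation tail_one :: "real^'n" where "tail_one \<equiv> tail (\<lambda>_. 1)"

text \<open>
  The three-dimensional space that contains all junior points other than axis vectors.
\<close>

definition V :: "(real^'n) set" where "V = {x. \<forall>j\<in>I. \<forall>k\<in>I. x $ j = x $ k}"

lemma V_nth_eq: "x \<in> V \<Longrightarrow> j \<in> I \<Longrightarrow> k \<in> I \<Longrightarrow> x $ j = x $ k"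
  unfolding V_def by blast

lemma card_I: "card I = m" and m_pos: "m \<ge> 1"
proof -
  show "card I = m" using pq by (simp add: I_def m_def card_Diff_singleton_if Compl_eq_Diff_UNIV numeral_2_eq_2)
  show "m \<ge> 1" using card by (simp add: m_def)
qed

lemma I_nonempty: "I \<noteq> {}" using card_I m_pos by auto

lemma not_in_I [simp]: "p \<notin> I" "q \<notin> I" by (auto simp: I_def)

lemma cases_I: obtains "i = p" | "i = q" | "i \<in> I" by (auto simp: I_def)

lemma tail_nth [simp]: "tail k $ p = 0" "tail k $ q = 0" "i \<in> I \<Longrightarrow> tail k $ i = of_int (k i)"
  by (auto simp: tail_def)

lemma age_tail: "age (tail k) = (\<Sum>i\<in>I. of_int (k i))"
  unfolding age_def tail_def by (simp add: sum.If_cases)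

lemma age_tail_one: "age tail_one = real m"
  by (simp add: age_tail card_I)

lemma zero_in: "0 \<in> L" using diff_in[OF axis_in axis_in] by (metis diff_self)

lemma neg_in: "x \<in> L \<Longrightarrow> - x \<in> L" using diff_in[OF zero_in, of x] by simp

lemma add_in: "x \<in> L \<Longrightarrow> y \<in> L \<Longrightarrow> x + y \<in> L" using diff_in[OF _ neg_in, of x y] by simp

lemma of_int_scale_in: "x \<in> L \<Longrightarrow> of_int k *\<^sub>R x \<in> L"
proof (induction k rule: int_induct[of _ 0])
  case base then show ?case by (simp add: zero_in)
next
  case (step1 i) then show ?case by (simp add: scaleR_add_left add_in)
next
  case (step2 i) then show ?case by (simp add: scaleR_diff_left diff_in)
qed

lemma sum_in: "(\<And>u. u \<in> S \<Longrightarrow> x u \<in> L) \<Longrightarrow> (\<Sum>u\<in>S. x u) \<in> L"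
  by (induction S rule: infinite_finite_induct) (auto simp: zero_in add_in)

lemma tail_eq_sum: "tail k = (\<Sum>i\<in>I. of_int (k i) *\<^sub>R axis i 1)"
  by (auto simp: tail_def vec_eq_iff axis_def if_distrib[of "\<lambda>x. _ * x"] cong: if_cong)

lemma tail_in: "tail k \<in> L"
  unfolding tail_eq_sum by (intro sum_in of_int_scale_in axis_in)

text \<open>
  The coordinates in \<open>I\<close> lie in \<open>[0,1]\<close> and differ by integers. If two of them are different, one
  equals \<open>1\<close>, which exhausts the age.
\<close>

lemma junior_point_cases:
  assumes "u \<in> junior_points L"
  obtains "u \<in> V" | j where "j \<in> I" "u = axis j 1"
proof (cases "u \<in> V")
  case True
  then show ?thesis using that by blast
next
  case False
  then obtain j k where jk: "j \<in> I" "k \<in> I" "u $ j \<noteq> u $ k" by (auto simp: V_def)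
  have u: "u \<in> L" "\<And>i. 0 \<le> u $ i" "(\<Sum>i\<in>UNIV. u $ i) = 1"
    using assms by (auto simp: junior_points_def age_def)
  have le: "u $ i + u $ j \<le> 1" if "i \<noteq> j" for i j
  proof -
    have "(\<Sum>i\<in>{i, j}. u $ i) \<le> (\<Sum>i\<in>UNIV. u $ i)" by (rule sum_mono2) (use u in auto)
    then show ?thesis using that u(3) by simp
  qed
  have "\<exists>j\<in>I. u $ j = 1"
  proof -
    have "u $ j - u $ k \<in> \<int>" using tail_diff_Ints u(1) jk by (auto simp: I_def)
    then obtain z where z: "u $ j - u $ k = of_int z" by (auto elim: Ints_cases)
    have "j \<noteq> k" using jk by auto
    then have "u $ j + u $ k \<le> 1" by (rule le)
    moreover have "z \<noteq> 0" using z jk(3) by auto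
    then have "z \<ge> 1 \<or> z \<le> - 1" by linarith
    then have "of_int z \<ge> (1::real) \<or> of_int z \<le> (- 1::real)" by linarith
    ultimately have "u $ j = 1 \<or> u $ k = 1"
      using u(2)[of j] u(2)[of k] z by linarith
    then show ?thesis using jk by blast
  qed
  then obtain j where j: "j \<in> I" "u $ j = 1" by blast
  have "u $ i = 0" if "i \<noteq> j" for i using le[OF that] u(2)[of i] j by simp
  then have "u = axis j 1" using j by (auto simp: vec_eq_iff axis_def)
  then show ?thesis using that j by blast
qed

text \<open>
  Consecutive points \<open>a\<close>, \<open>b\<close> of the chain. The last conjunct says that
  the cone generated by \<open>e\<^sub>p\<close>, \<open>a\<close> and the axes in \<open>I\<close>
  has index \<open>r = 1 + d + m c\<close> and that \<open>b\<close> is its point \<open>(1, d, c,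
  \<dots>, c) / r\<close>.
\<close>

definition chain_state :: "real^'n \<Rightarrow> real^'n \<Rightarrow> nat \<Rightarrow> nat \<Rightarrow> bool" where
  "chain_state a b d c \<longleftrightarrow>
     a \<in> L \<and> b \<in> L \<and> a \<in> V \<and> b \<in> V \<and> (\<forall>i. 0 \<le> a $ i) \<and> (\<forall>i. 0 \<le> b $ i) \<and> age a = 1 \<and> age b = 1 \<and>
     (\<forall>x\<in>L. \<exists>\<alpha> \<beta> k. x = of_int \<alpha> *\<^sub>R a + of_int \<beta> *\<^sub>R b + tail k) \<and>
     real (1 + d + m * c) *\<^sub>R b = axis p 1 + real d *\<^sub>R a + real c *\<^sub>R tail_one"

text \<open>
  The next point \<open>P\<close> is the point \<open>(1, s, c mod d, \<dots>) / d\<close> of the cone generated by \<open>e\<^sub>p\<close>, \<open>b\<close> and the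
  axes in \<open>I\<close>, where \<open>g\<close> is its age. Eliminating \<open>e\<^sub>p\<close> by means of the equation for \<open>b\<close> expresses
  it by integral coefficients in \<open>b\<close>, \<open>a\<close> and the axes. As the coefficient of \<open>a\<close> is \<open>-1\<close>, exchanging
  \<open>a\<close> for \<open>P\<close> preserves the lattice basis.
\<close>

context
  fixes a b d c g s P
  assumes st: "chain_state a b d c" and d: "d \<ge> 2"
    and g: "1 + s + m * (c mod d) = g * d"
  defines "P \<equiv> (1 + real g + real m * real (c div d)) *\<^sub>R b - a - real (c div d) *\<^sub>R tail_one"
begin

lemma next_point_eq:
  "real d *\<^sub>R P = axis p 1 + real s *\<^sub>R b + real (c mod d) *\<^sub>R tail_one"
proof -
  define h where "h = c div d"
  define e where "e = c mod d"
  have c: "real c = real h * real d + real e"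
    unfolding h_def e_def by (metis div_mult_mod_eq of_nat_add of_nat_mult)
  have g': "real g * real d = 1 + real s + real m * real e"
    using g unfolding e_def[symmetric] by (metis of_nat_1 of_nat_add of_nat_mult)
  have ax: "axis p 1 = real (1 + d + m * c) *\<^sub>R b - real d *\<^sub>R a - real c *\<^sub>R tail_one"
    using st by (simp add: chain_state_def)
  have "real d * (1 + real g + real m * real h) = real (1 + d + m * c) + real s"
    using c g' by (simp add: algebra_simps)
  then have "real d *\<^sub>R P = (real (1 + d + m * c) + real s) *\<^sub>R b - real d *\<^sub>R a - (real d * real h) *\<^sub>R tail_one"
    unfolding P_def h_def by (simp add: scaleR_diff_right)
  also have "real d * real h = real c - real e" using c by simp
  finally show ?thesis unfolding ax e_def[symmetric] by (simp add: algebra_simps)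
qed

lemma next_point_in: "P \<in> L"
proof -
  have "P = of_int (1 + int g + int m * int (c div d)) *\<^sub>R b - a - of_int (int (c div d)) *\<^sub>R tail_one"
    by (simp add: P_def)
  also have "\<dots> \<in> L"
    using st by (intro diff_in of_int_scale_in tail_in) (auto simp: chain_state_def)
  finally show ?thesis .
qed

lemma next_point_symmetric: "P \<in> V"
proof -
  have "P $ j = P $ k" if jk: "j \<in> I" "k \<in> I" for j k
  proof -
    have "a \<in> V" "b \<in> V" using st by (auto simp: chain_state_def)
    then have "a $ j = a $ k" "b $ j = b $ k" using V_nth_eq jk by blast+
    then show ?thesis using jk by (simp add: P_def)
  qed
  then show ?thesis unfolding V_def by blast
qed

lemma next_point_nth:
  "real d * P $ i = (if i = p then 1 else 0) + real s * b $ i + (if i \<in> I then real (c mod d) else 0)"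
proof -
  have "real d * P $ i = (real d *\<^sub>R P) $ i" by simp
  also have "\<dots> = axis p 1 $ i + real s * b $ i + real (c mod d) * tail_one $ i"
    unfolding next_point_eq by simp
  also have "axis p 1 $ i = (if i = p then 1 else (0::real))" by (auto simp: axis_def)
  also have "real (c mod d) * tail_one $ i = (if i \<in> I then real (c mod d) else 0)"
    by (simp add: tail_def)
  finally show ?thesis .
qed

lemma next_point_nonneg: "0 \<le> P $ i"
proof -
  have "0 \<le> b $ i" using st by (simp add: chain_state_def)
  then have "0 \<le> real d * P $ i" unfolding next_point_nth by simp
  then show ?thesis using d by (simp add: zero_le_mult_iff)
qed

lemma next_point_age: "age P = real g"
proof -
  have "real d * age P = 1 + real s + real (c mod d) * real m"
    using arg_cong[OF next_point_eq, of age] st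
    by (simp add: age_add age_scaleR age_axis age_tail_one chain_state_def)
  also have "\<dots> = real (1 + s + m * (c mod d))" by simp
  also have "\<dots> = real d * real g" unfolding g by simp
  finally show ?thesis using d by simp
qed

lemma next_point_generates:
  assumes "x \<in> L"
  shows "\<exists>\<alpha> \<beta> k. x = of_int \<alpha> *\<^sub>R b + of_int \<beta> *\<^sub>R P + tail k"
proof -
  obtain \<alpha> \<beta> k where x: "x = of_int \<alpha> *\<^sub>R a + of_int \<beta> *\<^sub>R b + tail k"
    using st assms unfolding chain_state_def by blast
  define h where "h = int (c div d)"
  have a: "a = of_int (1 + int g + int m * h) *\<^sub>R b - P - of_int h *\<^sub>R tail_one"
    by (simp add: P_def h_def)
  have "x = of_int (\<beta> + \<alpha> * (1 + int g + int m * h)) *\<^sub>R b + of_int (- \<alpha>) *\<^sub>R P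
      + tail (\<lambda>i. k i - \<alpha> * h)"
    unfolding x
    by (subst a) (auto simp: vec_eq_iff tail_def algebra_simps)
  then show ?thesis by blast
qed

lemma next_state:
  assumes "g = 1"
  shows "chain_state b P s (c mod d)"
proof -
  have "1 + s + m * (c mod d) = d" using g assms by simp
  then show ?thesis
    using st next_point_in next_point_symmetric next_point_nonneg next_point_age assms
      next_point_generates next_point_eq
    unfolding chain_state_def by simp
qed

end

text \<open>
  Let \<open>P\<close> be the next point, of age \<open>g\<close>. Its \<open>q\<close>-coordinate
  is smaller than that of \<open>b\<close>. A lattice point of the orthant with this property has
  coefficient \<open>\<alpha> \<le> 0\<close> at \<open>a\<close>, and if \<open>\<alpha> =
  0\<close> it lies in the span of the axes in \<open>I\<close> (fact \<open>sign\<close>). As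
  \<open>P\<close> has \<open>\<alpha> = -1\<close>, it is the sum of one junior point
  \<open>u\<close> with \<open>\<alpha> = -1\<close> and a vector in that span, which by symmetry is
  \<open>n\<close> times the sum of those axes. Then \<open>g = 1 + m n\<close>, and as the entries
  of the fraction for \<open>P\<close> are less than its denominator, \<open>n = 0\<close>. The
  bound on the \<open>p\<close>-coordinate of \<open>a\<close> makes the
  \<open>p\<close>-coordinates increase along the chain, on which the fact \<open>sign\<close>
  rests; it is inherited because \<open>c mod d \<le> c\<close>.
\<close>

lemma chain_forced:
  assumes dec: "\<And>x. x \<in> L \<Longrightarrow> (\<And>i. 0 \<le> x $ i) \<Longrightarrow>
      \<exists>S k. finite S \<and> S \<subseteq> junior_points L \<and> x = (\<Sum>u\<in>S. of_nat (k u) *\<^sub>R u)"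
  shows "chain_state a b d c \<Longrightarrow> a $ p * (1 + real m * real c) < 1 \<Longrightarrow> 0 < a $ q \<Longrightarrow> a $ q \<le> 1
    \<Longrightarrow> age_one_chain m d c"
proof (induction d arbitrary: a b c rule: less_induct)
  case (less d)
  note st = less.prems(1)
  show ?case
  proof (cases "d \<le> 1")
    case True
    then show ?thesis by (simp add: age_one_chain.simps)
  next
    case False
    then have d: "d \<ge> 2" by simp
    define e where "e = c mod d"
    have ed: "e < d" using d by (simp add: e_def)
    \<comment> \<open>\<open>g\<close> is \<open>(1 + m * e) / d\<close> rounded up, so that the entry \<open>s\<close> lies between \<open>0\<close> and \<open>d - 1\<close>.\<close>
    define g where "g = (m * e + d) div d"
    define s where "s = g * d - 1 - m * e"
    have gd: "g * d \<le> m * e + d" "m * e + d < g * d + d"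
      using d by (auto simp: g_def dividend_less_div_times)
    then have gs: "1 + s + m * e = g * d" by (simp add: s_def)
    have sd: "s < d" using gd d by (simp add: s_def)
    define P where "P = (1 + real g + real m * real (c div d)) *\<^sub>R b - a - real (c div d) *\<^sub>R tail_one"
    note P = next_point_in next_point_symmetric next_point_nonneg next_point_age next_point_nth
    note P = P[OF st d gs[unfolded e_def], folded P_def e_def]
    let ?r = "real (1 + d + m * c)"
    have req: "?r *\<^sub>R b = axis p 1 + real d *\<^sub>R a + real c *\<^sub>R tail_one"
      using st by (simp add: chain_state_def)
    have bp: "?r * b $ p = 1 + real d * a $ p"
      using arg_cong[OF req, of "\<lambda>x. x $ p"] by (simp add: axis_def)
    have bq: "?r * b $ q = real d * a $ q"
      using arg_cong[OF req, of "\<lambda>x. x $ q"] pq by (simp add: axis_def)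
    have "0 \<le> real m * real c" by simp
    then have r: "?r > 0" "?r > real d" unfolding of_nat_add of_nat_mult of_nat_1 by linarith+
    have ap: "0 \<le> a $ p" using st by (simp add: chain_state_def)
    have "?r * a $ p < ?r * b $ p"
      unfolding bp using less.prems(2) by (simp add: algebra_simps)
    then have ab_p: "a $ p < b $ p" using r by (simp add: mult_less_cancel_left)
    have "?r * b $ q < ?r * a $ q" unfolding bq using r less.prems(3) by (simp add: mult_less_cancel_right)
    then have ab_q: "b $ q < a $ q" using r by (simp add: mult_less_cancel_left)
    have "0 < ?r * b $ q" unfolding bq using less.prems(3) d by simp
    then have bq_pos: "0 < b $ q" using r by (simp add: zero_less_mult_iff)
    have sign: "\<alpha> \<le> 0 \<and> (\<alpha> = 0 \<longrightarrow> \<beta> = 0)"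
      if x: "x = of_int \<alpha> *\<^sub>R a + of_int \<beta> *\<^sub>R b + tail k" "\<And>i. 0 \<le> x $ i" "x $ q < b $ q"
      for x \<alpha> \<beta> k
    proof -
      have xp: "x $ p = of_int \<alpha> * a $ p + of_int \<beta> * b $ p"
        and xq: "x $ q = of_int \<alpha> * a $ q + of_int \<beta> * b $ q" by (simp_all add: x(1))
      have "\<alpha> \<le> 0"
      proof (rule ccontr)
        assume "\<not> \<alpha> \<le> 0"
        then have \<alpha>: "\<alpha> \<ge> 1" by simp
        have "of_int \<alpha> * b $ q < of_int \<alpha> * a $ q" using \<alpha> ab_q by simp
        then have "(of_int \<alpha> + of_int \<beta> - 1) * b $ q < 0" using x(3) xq by (simp add: algebra_simps)
        then have "(of_int \<alpha> + of_int \<beta> - 1 :: real) < 0" using bq_pos by (simp add: mult_less_0_iff)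
        then have le: "\<alpha> \<le> - \<beta>" by linarith
        have "of_int \<alpha> * b $ p \<le> of_int (- \<beta>) * b $ p"
          using le ab_p ap by (intro mult_right_mono) auto
        also have "\<dots> \<le> of_int \<alpha> * a $ p" using x(2)[of p] xp by simp
        also have "\<dots> < of_int \<alpha> * b $ p" using \<alpha> ab_p by simp
        finally show False by simp
      qed
      moreover have "\<beta> = 0" if "\<alpha> = 0"
      proof -
        have "0 \<le> of_int \<beta> * b $ q" "of_int \<beta> * b $ q < 1 * b $ q"
          using x(2)[of q] x(3) xq that by simp_all
        then have "0 \<le> (of_int \<beta> :: real)" "(of_int \<beta> :: real) < 1"
          using bq_pos by (simp_all add: zero_le_mult_iff mult_less_cancel_right)
        then show ?thesis by simp
      qed
      ultimately show ?thesis by blast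
    qed
    have "real d * P $ q = real s * b $ q" using P(5)[of q] pq by simp
    also have "\<dots> < real d * b $ q" using sd bq_pos by simp
    finally have Pq: "P $ q < b $ q" using d by (simp add: mult_less_cancel_left)
    \<comment> \<open>Up to the negative factor \<open>G a\<close>, the functional \<open>G\<close> reads off the coefficient \<open>\<alpha>\<close>.\<close>
    define G where "G = (\<lambda>x. x $ p * b $ q - x $ q * b $ p)"
    have G_comb: "G x = of_int \<alpha> * G a" if "x = of_int \<alpha> *\<^sub>R a + of_int \<beta> *\<^sub>R b + tail k" for x \<alpha> \<beta> k
      unfolding G_def that by (simp add: algebra_simps)
    have "?r * G a = a $ p * (?r * b $ q) - a $ q * (?r * b $ p)" by (simp add: G_def algebra_simps)
    also have "\<dots> = - (a $ q)" unfolding bp bq by (simp add: algebra_simps)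
    also have "\<dots> < 0" using less.prems(3) by simp
    finally have Ga: "G a < 0" using r by (simp add: mult_less_0_iff)
    have GP: "G P = - G a"
      using G_comb[of P "-1" "1 + int g + int m * int (c div d)" "\<lambda>_. - int (c div d)"]
      by (simp add: P_def vec_eq_iff tail_def)
    obtain S k where S: "finite S" "S \<subseteq> junior_points L" "P = (\<Sum>u\<in>S. of_nat (k u) *\<^sub>R u)"
      using dec[OF P(1,3)] by blast
    have PS: "P $ i = (\<Sum>u\<in>S. of_nat (k u) * u $ i)" for i
      unfolding S(3) by (simp add: sum_component)
    have "G P = (\<Sum>u\<in>S. of_nat (k u) * G u)"
      unfolding G_def PS by (simp add: sum_distrib_left sum_distrib_right sum_subtractf algebra_simps)
    then have "\<not> (\<forall>u\<in>S. of_nat (k u) * G u \<le> 0)"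
      using GP Ga sum_nonpos[of S "\<lambda>u. of_nat (k u) * G u"] by fastforce
    then obtain u where u: "u \<in> S" "of_nat (k u) * G u > 0" by auto
    then have ku: "k u \<ge> 1" and Gu: "G u > 0" by (auto simp: zero_less_mult_iff Suc_le_eq)
    have uJ: "u \<in> L" "\<And>i. 0 \<le> u $ i" "age u = 1" using u S by (auto simp: junior_points_def)
    have Pu: "0 \<le> (P - u) $ i" for i
    proof -
      have "1 * u $ i \<le> of_nat (k u) * u $ i" using ku uJ by (intro mult_right_mono) auto
      also have "\<dots> \<le> P $ i"
        unfolding PS using u S by (intro member_le_sum) (auto simp: junior_points_def)
      finally show ?thesis by simp
    qed
    have "P - u \<in> L" using P uJ by (intro diff_in)
    then obtain \<alpha>' \<beta>' k' where Pu_eq: "P - u = of_int \<alpha>' *\<^sub>R a + of_int \<beta>' *\<^sub>R b + tail k'"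
      using st unfolding chain_state_def by blast
    obtain \<alpha> \<beta> l where u_eq: "u = of_int \<alpha> *\<^sub>R a + of_int \<beta> *\<^sub>R b + tail l"
      using st uJ unfolding chain_state_def by blast
    have "G (P - u) = G P - G u" by (simp add: G_def algebra_simps)
    then have "of_int \<alpha>' * G a = (- 1 - of_int \<alpha>) * G a"
      using G_comb[OF Pu_eq] G_comb[OF u_eq] GP by (simp add: algebra_simps)
    then have "real_of_int \<alpha>' = - 1 - of_int \<alpha>" using Ga by simp
    then have "\<alpha>' = - 1 - \<alpha>" by linarith
    moreover have "\<alpha> < 0" using Gu Ga G_comb[OF u_eq] by (simp add: zero_less_mult_iff)
    moreover have "\<alpha>' \<le> 0 \<and> (\<alpha>' = 0 \<longrightarrow> \<beta>' = 0)"
      by (rule sign[OF Pu_eq Pu]) (use Pq uJ(2)[of q] in simp)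
    ultimately have "\<alpha>' = 0" "\<beta>' = 0" by auto
    then have tail: "P - u = tail k'" using Pu_eq by simp
    have "u \<in> junior_points L" using S(2) u(1) by blast
    then have "u \<in> V"
    proof (cases rule: junior_point_cases)
      case (2 j)
      then have "p \<noteq> j" "q \<noteq> j" using not_in_I by metis+
      then have "G u = 0" using 2 by (simp add: G_def axis_def)
      then show ?thesis using Gu by simp
    qed auto
    obtain j where j: "j \<in> I" using I_nonempty by blast
    define n where "n = k' j"
    have kn: "k' i = n" if "i \<in> I" for i
    proof -
      have "(P - u) $ i = (P - u) $ j" using V_nth_eq[OF P(2) that j] V_nth_eq[OF \<open>u \<in> V\<close> that j] by simp
      then show ?thesis using j that by (simp add: tail n_def)
    qed
    have "0 \<le> n" using Pu[of j] j by (simp add: tail n_def)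
    have "age (P - u) = real m * of_int n" by (simp add: tail age_tail kn card_I)
    then have "real g - 1 = real m * of_int n" using P(4) uJ by (simp add: age_diff)
    then have "real_of_int (int g) = real_of_int (1 + int m * n)" by simp
    then have gn: "int g = 1 + int m * n" by (simp only: of_int_eq_iff)
    have "n = 0"
    proof (rule ccontr)
      assume "n \<noteq> 0"
      then have n: "n \<ge> 1" using \<open>0 \<le> n\<close> by simp
      have "1 + int s + int m * int e = (1 + int m * n) * int d"
        using gs gn by (metis of_nat_1 of_nat_add of_nat_mult)
      moreover have "int m * int e < int m * (n * int d)"
      proof (rule mult_strict_left_mono)
        have "1 * int d \<le> n * int d" using n by (intro mult_right_mono) auto
        then show "int e < n * int d" using ed by linarith
      qed (use m_pos in simp)
      moreover have "(1 + int m * n) * int d = int d + int m * (n * int d)"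
        by (simp add: algebra_simps)
      ultimately show False using sd by linarith
    qed
    then have g1: "g = 1" using gn by simp
    have "chain_state b P s e"
      using next_state[OF st d gs[unfolded e_def] g1] by (simp add: P_def e_def)
    moreover have "b $ p * (1 + real m * real e) < 1"
    proof -
      have "?r * (b $ p * (1 + real m * real c)) = (1 + real m * real c) + real d * (a $ p * (1 + real m * real c))"
        unfolding mult.assoc[symmetric] bp by (simp add: algebra_simps)
      also have "\<dots> < (1 + real m * real c) + real d * 1" using less.prems(2) d by simp
      also have "\<dots> = ?r * 1" by simp
      finally have "b $ p * (1 + real m * real c) < 1" using r by (simp only: mult_less_cancel_left_pos)
      moreover have "b $ p * (1 + real m * real e) \<le> b $ p * (1 + real m * real c)"
        using ab_p ap by (intro mult_left_mono add_left_mono) (auto simp: e_def)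
      ultimately show ?thesis by simp
    qed
    moreover have "b $ q \<le> 1" using ab_q less.prems(4) by simp
    moreover have "s < d" by (rule sd)
    ultimately have "age_one_chain m s e" using less.IH bq_pos by blast
    moreover have "s = d - 1 - m * e" by (simp add: s_def g1)
    moreover have "m * e + 1 \<le> d" using gs g1 by simp
    ultimately show ?thesis using False by (simp add: age_one_chain.simps[of m d c] e_def)
  qed
qed

end

section \<open>Triangulations and star subdivisions\<close>

text \<open>
  \<open>l\<close> writes \<open>x\<close> as a point of the cone of one member of \<open>F\<close>.
  Summation over a fixed finite set \<open>J\<close> of candidate vertices makes representations in
  different cones comparable.
\<close>

definition cone_rep :: "'a::euclidean_space set \<Rightarrow> 'a set set \<Rightarrow> 'a \<Rightarrow> ('a \<Rightarrow> real) \<Rightarrow> bool" where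
  "cone_rep J F x l \<longleftrightarrow>
     (\<forall>u. 0 \<le> l u) \<and> (\<exists>S\<in>F. \<forall>u. l u \<noteq> 0 \<longrightarrow> u \<in> S) \<and> x = (\<Sum>u\<in>J. l u *\<^sub>R u)"

text \<open>
  The members of \<open>F\<close> are the generator sets of the maximal cones. Existence of
  representations says that the cones cover \<open>X\<close>. Uniqueness, demanded at every point,
  says at once that each cone is simplicial and that any two cones meet in the cone of their common
  generators.
\<close>

definition triangulates :: "'a::euclidean_space set \<Rightarrow> 'a set set \<Rightarrow> 'a set \<Rightarrow> bool" where
  "triangulates J F X \<longleftrightarrow>
     finite J \<and> (\<forall>S\<in>F. S \<subseteq> J \<and> card S = DIM('a)) \<and>
     (\<forall>x\<in>X. \<exists>l. cone_rep J F x l) \<and>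
     (\<forall>x l l'. cone_rep J F x l \<longrightarrow> cone_rep J F x l' \<longrightarrow> l = l')"

lemma triangulatesD:
  fixes J :: "'a::euclidean_space set"
  assumes tr: "triangulates J F X"
  shows "finite J" "S \<in> F \<Longrightarrow> S \<subseteq> J" "S \<in> F \<Longrightarrow> finite S" "S \<in> F \<Longrightarrow> card S = DIM('a)"
    "x \<in> X \<Longrightarrow> \<exists>l. cone_rep J F x l"
    "cone_rep J F y l \<Longrightarrow> cone_rep J F y l' \<Longrightarrow> l = l'"
proof -
  note * = tr[unfolded triangulates_def]
  show fin: "finite J" using * by (rule conjunct1)
  show sub: "S \<subseteq> J" if "S \<in> F" using * that by simp
  show "finite S" if "S \<in> F" using sub[OF that] fin by (rule finite_subset)
  show "card S = DIM('a)" if "S \<in> F" using * that by simp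
  show "\<exists>l. cone_rep J F x l" if "x \<in> X" using * that by simp
  show "l = l'" if "cone_rep J F y l" "cone_rep J F y l'" using * that by meson
qed

lemma cone_rep_sum:
  assumes tr: "triangulates J F X" and T: "T \<in> F" "S \<subseteq> T" and l: "\<And>u. u \<in> S \<Longrightarrow> 0 \<le> l u"
  shows "cone_rep J F (\<Sum>u\<in>S. l u *\<^sub>R u) (\<lambda>u. if u \<in> S then l u else 0)"
  unfolding cone_rep_def
proof (intro conjI)
  have "S \<subseteq> J" using triangulatesD(2)[OF tr] T by blast
  then show "(\<Sum>u\<in>S. l u *\<^sub>R u) = (\<Sum>u\<in>J. (if u \<in> S then l u else 0) *\<^sub>R u)"
    by (intro sum.mono_neutral_cong_left) (use triangulatesD(1)[OF tr] in auto)
  show "\<exists>S'\<in>F. \<forall>u. (if u \<in> S then l u else 0) \<noteq> 0 \<longrightarrow> u \<in> S'"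
    using T by (intro bexI[of _ T]) auto
qed (use l in auto)

lemma cone_rep_sum_facet:
  assumes tr: "triangulates J F X" and S: "S \<in> F" "\<And>u. l u \<noteq> 0 \<Longrightarrow> u \<in> S"
  shows "(\<Sum>u\<in>J. l u *\<^sub>R u) = (\<Sum>u\<in>S. l u *\<^sub>R u)"
proof (rule sum.mono_neutral_right)
  have "l u = 0" if "u \<notin> S" for u using S(2) that by blast
  then show "\<forall>u\<in>J - S. l u *\<^sub>R u = 0" by simp
qed (use triangulatesD(1,2)[OF tr] S in blast)+

text \<open>
  The positive and the negative part of a linear relation represent the same point.
\<close>

lemma triangulates_independent:
  assumes tr: "triangulates J F X" and S: "S \<in> F"
  shows "independent S"
proof (rule independent_if_scalars_zero)
  show "finite S" by (rule triangulatesD(3)[OF tr S])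
  fix f u assume f: "(\<Sum>u\<in>S. f u *\<^sub>R u) = 0" and u: "u \<in> S"
  have "(\<Sum>u\<in>S. max (f u) 0 *\<^sub>R u) - (\<Sum>u\<in>S. max (- f u) 0 *\<^sub>R u)
      = (\<Sum>u\<in>S. (max (f u) 0 - max (- f u) 0) *\<^sub>R u)"
    by (simp add: sum_subtractf scaleR_diff_left)
  also have "\<dots> = (\<Sum>u\<in>S. f u *\<^sub>R u)" by (intro sum.cong) (auto simp: max_def)
  finally have eq: "(\<Sum>u\<in>S. max (f u) 0 *\<^sub>R u) = (\<Sum>u\<in>S. max (- f u) 0 *\<^sub>R u)" using f by simp
  have "(\<lambda>u. if u \<in> S then max (f u) 0 else 0) = (\<lambda>u. if u \<in> S then max (- f u) 0 else 0)"
    using cone_rep_sum[OF tr S subset_refl, of "\<lambda>u. max (f u) 0"]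
      cone_rep_sum[OF tr S subset_refl, of "\<lambda>u. max (- f u) 0"]
    unfolding eq by (intro triangulatesD(6)[OF tr]) auto
  from fun_cong[OF this, of u] have "max (f u) 0 = max (- f u) 0" using u by simp
  then show "f u = 0" by (auto simp: max_def split: if_splits)
qed

lemma triangulates_vertex_rep:
  assumes tr: "triangulates J F X" and v: "v \<in> \<Union>F"
  shows "cone_rep J F v (\<lambda>u. if u = v then 1 else 0)"
proof -
  obtain T where T: "T \<in> F" "{v} \<subseteq> T" using v by auto
  show ?thesis using cone_rep_sum[OF tr T, of "\<lambda>_. 1"] by (simp cong: if_cong)
qed

text \<open>
  The subdivision at the point \<open>v\<close> with representation \<open>a\<close>: in each cone
  that contains the support of \<open>a\<close>, the point \<open>v\<close> replaces the elements of
  the support, one at a time.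
\<close>

definition star_subdivision :: "('a \<Rightarrow> real) \<Rightarrow> 'a \<Rightarrow> 'a set set \<Rightarrow> 'a set set" where
  "star_subdivision a v F = {S\<in>F. \<not> {u. a u \<noteq> 0} \<subseteq> S} \<union>
     {insert v (S - {u}) | S u. S \<in> F \<and> {u. a u \<noteq> 0} \<subseteq> S \<and> a u \<noteq> 0}"

context
  fixes J :: "'a::euclidean_space set" and F X v a
  assumes tr: "triangulates J F X" and vJ: "v \<in> J" "v \<notin> \<Union>F" and v0: "v \<noteq> 0"
    and a: "cone_rep J F v a"
begin

lemma star_center_coefficient: "a v = 0"
  using a vJ unfolding cone_rep_def by blast

lemma star_support_nonempty: "\<exists>u. a u \<noteq> 0"
proof (rule ccontr)
  assume "\<not> ?thesis"
  then have "v = 0" using a by (simp add: cone_rep_def)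
  then show False using v0 by simp
qed

lemma sum_center: "(\<Sum>u\<in>J. (if u = v then t else 0) *\<^sub>R u) = t *\<^sub>R v"
  using triangulatesD(1)[OF tr] vJ
  by (simp add: if_distrib[of "\<lambda>x. x *\<^sub>R _"] cong: if_cong)

text \<open>
  Trade as much of the support of \<open>a\<close> for \<open>v\<close> as possible; the largest
  possible amount makes one coefficient vanish.
\<close>

lemma star_rep_exists:
  assumes l: "cone_rep J F x l"
  shows "\<exists>l'. cone_rep J (star_subdivision a v F) x l'"
proof -
  obtain S where S: "S \<in> F" "\<And>u. l u \<noteq> 0 \<Longrightarrow> u \<in> S" using l by (auto simp: cone_rep_def)
  have x: "x = (\<Sum>u\<in>J. l u *\<^sub>R u)" and l0: "\<And>u. 0 \<le> l u" using l by (auto simp: cone_rep_def)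
  have v: "v = (\<Sum>u\<in>J. a u *\<^sub>R u)" and a0: "\<And>u. 0 \<le> a u" using a by (auto simp: cone_rep_def)
  show ?thesis
  proof (cases "{u. a u \<noteq> 0} \<subseteq> S")
    case False
    then have "S \<in> star_subdivision a v F" using S by (auto simp: star_subdivision_def)
    then have "cone_rep J (star_subdivision a v F) x l"
      unfolding cone_rep_def using S x l0 by blast
    then show ?thesis by blast
  next
    case True
    let ?A = "{u. a u \<noteq> 0}"
    have fin: "finite ?A" using True triangulatesD(3)[OF tr S(1)] finite_subset by blast
    define t where "t = Min ((\<lambda>u. l u / a u) ` ?A)"
    have "t \<in> (\<lambda>u. l u / a u) ` ?A" unfolding t_def
      by (rule Min_in) (use fin star_support_nonempty in auto)
    then obtain w where w: "a w \<noteq> 0" "t = l w / a w" by blast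
    have t0: "0 \<le> t" using w l0 a0 by simp
    have le: "t * a u \<le> l u" for u
    proof (cases "a u = 0")
      case False
      then have "t \<le> l u / a u" unfolding t_def using fin by (intro Min_le) auto
      moreover have "a u > 0" using False a0[of u] by simp
      ultimately show ?thesis by (simp add: pos_le_divide_eq)
    qed (use l0 in simp)
    define k where "k = (\<lambda>u. l u - t * a u + (if u = v then t else 0))"
    have wv: "w \<noteq> v" using w star_center_coefficient by auto
    have "x = (\<Sum>u\<in>J. k u *\<^sub>R u)"
    proof -
      have "(\<Sum>u\<in>J. k u *\<^sub>R u) = x - t *\<^sub>R v + t *\<^sub>R v"
        unfolding k_def scaleR_add_left scaleR_diff_left sum.distrib sum_subtractf sum_center
        by (simp add: x v[symmetric] scaleR_sum_right[symmetric] flip: scaleR_scaleR)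
      then show ?thesis by simp
    qed
    moreover have "\<forall>u. 0 \<le> k u" using le t0 by (auto simp: k_def)
    moreover have "insert v (S - {w}) \<in> star_subdivision a v F"
      using S True w by (auto simp: star_subdivision_def)
    moreover have "u \<in> insert v (S - {w})" if "k u \<noteq> 0" for u
    proof (cases "u = v")
      case False
      then have "u \<noteq> w" using that w wv by (auto simp: k_def)
      moreover have "u \<in> S" using that False S(2)[of u] True by (cases "a u = 0") (auto simp: k_def)
      ultimately show ?thesis by simp
    qed simp
    ultimately have "cone_rep J (star_subdivision a v F) x k" unfolding cone_rep_def by blast
    then show ?thesis by blast
  qed
qed

text \<open>
  Expanding \<open>v\<close> according to \<open>a\<close> leads back to the original triangulation.
  No cone of the subdivision contains the whole support of \<open>a\<close>, so some coefficient
  there is zero.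
\<close>

lemma star_rep_collapse:
  assumes l: "cone_rep J (star_subdivision a v F) x l"
  shows "cone_rep J F x (\<lambda>u. (if u = v then 0 else l u) + l v * a u)"
    and "\<exists>u. a u \<noteq> 0 \<and> l u = 0"
proof -
  obtain T where T: "T \<in> star_subdivision a v F" "\<And>u. l u \<noteq> 0 \<Longrightarrow> u \<in> T"
    using l by (auto simp: cone_rep_def)
  have x: "x = (\<Sum>u\<in>J. l u *\<^sub>R u)" and l0: "\<And>u. 0 \<le> l u" using l by (auto simp: cone_rep_def)
  have v: "v = (\<Sum>u\<in>J. a u *\<^sub>R u)" and a0: "\<And>u. 0 \<le> a u" using a by (auto simp: cone_rep_def)
  let ?k = "\<lambda>u. (if u = v then 0 else l u) + l v * a u"
  have x_eq: "x = (\<Sum>u\<in>J. ?k u *\<^sub>R u)"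
  proof -
    have "(\<Sum>u\<in>J. ?k u *\<^sub>R u) = (\<Sum>u\<in>J. (if u = v then 0 else l u) *\<^sub>R u) + l v *\<^sub>R v"
      unfolding scaleR_add_left sum.distrib
      by (simp add: v[symmetric] scaleR_sum_right[symmetric] flip: scaleR_scaleR)
    also have "l v *\<^sub>R v = (\<Sum>u\<in>J. (if u = v then l v else 0) *\<^sub>R u)" by (rule sum_center[symmetric])
    also have "(\<Sum>u\<in>J. (if u = v then 0 else l u) *\<^sub>R u) + \<dots> = (\<Sum>u\<in>J. l u *\<^sub>R u)"
      unfolding sum.distrib[symmetric] by (intro sum.cong) auto
    finally show ?thesis using x by simp
  qed
  have "(\<exists>S\<in>F. \<forall>u. ?k u \<noteq> 0 \<longrightarrow> u \<in> S) \<and> (\<exists>u. a u \<noteq> 0 \<and> l u = 0)"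
  proof (cases "T \<in> F \<and> \<not> {u. a u \<noteq> 0} \<subseteq> T")
    case True
    then have "l v = 0" using T(2)[of v] vJ by blast
    then have "\<forall>u. ?k u \<noteq> 0 \<longrightarrow> u \<in> T" using T(2) by auto
    moreover have "\<exists>u. a u \<noteq> 0 \<and> l u = 0" using True T(2) by blast
    ultimately show ?thesis using True by blast
  next
    case False
    then obtain S w where S: "S \<in> F" "{u. a u \<noteq> 0} \<subseteq> S" "a w \<noteq> 0" "T = insert v (S - {w})"
      using T(1) unfolding star_subdivision_def by blast
    have "w \<noteq> v" using S star_center_coefficient by auto
    then have "l w = 0" using T(2)[of w] S by auto
    moreover have "u \<in> S" if "?k u \<noteq> 0" for u
    proof (cases "a u = 0")
      case True
      then have "u \<noteq> v" "l u \<noteq> 0" using that by (auto split: if_splits)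
      then show ?thesis using T(2)[of u] S(4) by simp
    qed (use S(2) in auto)
    ultimately show ?thesis using S by blast
  qed
  then show "\<exists>u. a u \<noteq> 0 \<and> l u = 0" and "cone_rep J F x ?k"
    using x_eq l0 a0 unfolding cone_rep_def by auto
qed

text \<open>
  The collapsed representations agree. At a point of the support where \<open>l\<close> vanishes
  this gives \<open>k v \<le> l v\<close>, and symmetrically.
\<close>

lemma star_rep_unique:
  assumes l: "cone_rep J (star_subdivision a v F) x l"
    and k: "cone_rep J (star_subdivision a v F) x k"
  shows "l = k"
proof -
  have eq: "(\<lambda>u. (if u = v then 0 else l u) + l v * a u) = (\<lambda>u. (if u = v then 0 else k u) + k v * a u)"
    by (rule triangulatesD(6)[OF tr star_rep_collapse(1)[OF l] star_rep_collapse(1)[OF k]])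
  have eq': "l u + l v * a u = k u + k v * a u" if "u \<noteq> v" for u
    using fun_cong[OF eq, of u] that by simp
  have le: "h' v \<le> h v"
    if hu: "\<And>u. u \<noteq> v \<Longrightarrow> h u + h v * a u = h' u + h' v * a u"
      and h: "cone_rep J (star_subdivision a v F) x h"
      and h': "cone_rep J (star_subdivision a v F) x h'" for h h'
  proof -
    obtain u where u: "a u \<noteq> 0" "h u = 0" using star_rep_collapse(2)[OF h] by blast
    then have "u \<noteq> v" using star_center_coefficient by auto
    then have "h v * a u = h' u + h' v * a u" using hu u by fastforce
    moreover have "0 \<le> h' u" using h' by (simp add: cone_rep_def)
    ultimately have "h' v * a u \<le> h v * a u" by simp
    moreover have "a u > 0" using u a by (simp add: cone_rep_def order_less_le)
    ultimately show ?thesis by (simp add: mult_le_cancel_right)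
  qed
  have "l v = k v" using le[OF _ l k] le[OF _ k l] eq' by force
  then show ?thesis using eq' by (intro ext) (metis add_right_cancel)
qed

lemma star_triangulates: "triangulates J (star_subdivision a v F) X"
  unfolding triangulates_def
proof (intro conjI ballI allI impI)
  show "finite J" by (rule triangulatesD(1)[OF tr])
  fix x assume "x \<in> X"
  then show "\<exists>l. cone_rep J (star_subdivision a v F) x l"
    using triangulatesD(5)[OF tr] star_rep_exists by blast
next
  fix T assume T: "T \<in> star_subdivision a v F"
  have "T \<subseteq> J \<and> card T = DIM('a)"
  proof (cases "T \<in> F")
    case True
    then show ?thesis using triangulatesD[OF tr] by blast
  next
    case False
    then obtain S w where S: "S \<in> F" "{u. a u \<noteq> 0} \<subseteq> S" "a w \<noteq> 0" "T = insert v (S - {w})"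
      using T unfolding star_subdivision_def by blast
    have "v \<notin> S" "w \<in> S" using S vJ by auto
    moreover have "finite S" "card S = DIM('a)" "S \<subseteq> J" using triangulatesD[OF tr] S by blast+
    ultimately show ?thesis using S vJ
      by (auto simp: card_Diff_singleton_if card_gt_0_iff)
  qed
  then show "T \<subseteq> J" "card T = DIM('a)" by auto
next
  fix x l l'
  assume "cone_rep J (star_subdivision a v F) x l" "cone_rep J (star_subdivision a v F) x l'"
  then show "l = l'" by (rule star_rep_unique)
qed

end

text \<open>
  A vertex of a subdivided cone remains a vertex of the cones in which \<open>v\<close> replaces another
  element of the support.
\<close>

lemma star_vertices:
  assumes "u1 \<noteq> u2" "a u1 \<noteq> 0" "a u2 \<noteq> 0" and rep: "cone_rep J F v a"
  shows "insert v (\<Union>F) \<subseteq> \<Union>(star_subdivision a v F)"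
proof
  obtain S where S: "S \<in> F" "{u. a u \<noteq> 0} \<subseteq> S" using rep by (auto simp: cone_rep_def)
  fix u assume u: "u \<in> insert v (\<Union>F)"
  have new: "insert v (T - {w}) \<in> star_subdivision a v F"
    if "T \<in> F" "{u. a u \<noteq> 0} \<subseteq> T" "a w \<noteq> 0" for T w
    using that unfolding star_subdivision_def by blast
  show "u \<in> \<Union>(star_subdivision a v F)"
  proof (cases "u = v")
    case True
    then show ?thesis using new[OF S assms(2)] by blast
  next
    case False
    then obtain T where T: "T \<in> F" "u \<in> T" using u by auto
    show ?thesis
    proof (cases "{u. a u \<noteq> 0} \<subseteq> T")
      case True
      obtain w where "a w \<noteq> 0" "w \<noteq> u" using assms by metis
      then show ?thesis using new[OF T(1) True, of w] T by blast
    next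
      case False
      then have "T \<in> star_subdivision a v F" using T by (auto simp: star_subdivision_def)
      then show ?thesis using T by blast
    qed
  qed
qed

section \<open>From triangulations to fans\<close>

definition cones_of :: "'a::real_vector set set \<Rightarrow> 'a set set" where
  "cones_of F = {convex_cone hull S | S. \<exists>T\<in>F. S \<subseteq> T}"

lemma cones_of_intersection:
  assumes tr: "triangulates J F X" and S: "T \<in> F" "S \<subseteq> T" and S': "T' \<in> F" "S' \<subseteq> T'"
  shows "convex_cone hull S \<inter> convex_cone hull S' = convex_cone hull (S \<inter> S')"
proof
  have fin: "finite S" "finite S'" using triangulatesD(3)[OF tr] S S' finite_subset by metis+
  show "convex_cone hull S \<inter> convex_cone hull S' \<subseteq> convex_cone hull (S \<inter> S')"
  proof
    fix x assume x: "x \<in> convex_cone hull S \<inter> convex_cone hull S'"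
    obtain l where l: "\<And>u. 0 \<le> l u" "x = (\<Sum>u\<in>S. l u *\<^sub>R u)"
      using convex_cone_hull_finiteE[OF fin(1)] x by blast
    obtain k where k: "\<And>u. 0 \<le> k u" "x = (\<Sum>u\<in>S'. k u *\<^sub>R u)"
      using convex_cone_hull_finiteE[OF fin(2)] x by blast
    have eq: "(\<lambda>u. if u \<in> S then l u else 0) = (\<lambda>u. if u \<in> S' then k u else 0)"
      using cone_rep_sum[OF tr S, of l] cone_rep_sum[OF tr S', of k] l k
      by (intro triangulatesD(6)[OF tr, of x]) simp_all
    have "l u = 0" if "u \<in> S" "u \<notin> S'" for u using fun_cong[OF eq, of u] that by simp
    then have "x = (\<Sum>u\<in>S \<inter> S'. l u *\<^sub>R u)"
      unfolding l(2) by (intro sum.mono_neutral_right) (use fin in auto)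
    then show "x \<in> convex_cone hull (S \<inter> S')"
      using convex_cone_hull_finiteI[of "S \<inter> S'" l] fin l(1) by simp
  qed
  show "convex_cone hull (S \<inter> S') \<subseteq> convex_cone hull S \<inter> convex_cone hull S'"
    by (simp add: hull_mono)
qed

lemma strongly_convex_orthant_cone:
  fixes S :: "(real^'n::finite) set"
  assumes "S \<subseteq> positive_orthant"
  shows "strongly_convex (convex_cone hull S)"
proof -
  have orthant: "convex_cone (positive_orthant :: (real^'n) set)"
    by (auto simp: convex_cone_iff positive_orthant_def)
  have sub: "convex_cone hull S \<subseteq> positive_orthant" using assms orthant by (rule hull_minimal)
  have "x = 0" if x: "x \<in> convex_cone hull S" "- x \<in> convex_cone hull S" for x
  proof -
    have "0 \<le> x $ i" "0 \<le> (- x) $ i" for i using x sub by (auto simp: positive_orthant_def)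
    then show ?thesis by (simp add: vec_eq_iff order_antisym)
  qed
  then show ?thesis
    using convex_cone_hull_contains_0[of S] by (force simp: strongly_convex_def)
qed

lemma cones_of_fan:
  fixes J :: "(real^'n::finite) set"
  assumes tr: "triangulates J F positive_orthant" and JL: "J \<subseteq> L" and J: "J \<subseteq> positive_orthant"
  shows "fan L (cones_of F)" and "subdivides (cones_of F) positive_orthant"
proof -
  have "F \<subseteq> Pow J" using triangulatesD(2)[OF tr] by auto
  moreover have "finite (Pow J)" using triangulatesD(1)[OF tr] by simp
  ultimately have finF: "finite F" by (rule finite_subset)
  have sub: "S \<subseteq> J" "finite S" "independent S" if "T \<in> F" "S \<subseteq> T" for S T
    using subset_trans[OF that(2) triangulatesD(2)[OF tr that(1)]]
      finite_subset[OF that(2) triangulatesD(3)[OF tr that(1)]]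
      independent_mono[OF triangulates_independent[OF tr that(1)] that(2)]
    by simp_all
  have mem: "convex_cone hull S \<in> cones_of F" if "T \<in> F" "S \<subseteq> T" for S T
    using that by (auto simp: cones_of_def)
  show "fan L (cones_of F)" unfolding fan_def
  proof (intro conjI ballI allI impI)
    have "cones_of F = (\<lambda>S. convex_cone hull S) ` (\<Union>T\<in>F. Pow T)" by (auto simp: cones_of_def)
    moreover have "finite (\<Union>T\<in>F. Pow T)" using finF triangulatesD(3)[OF tr] by auto
    ultimately show "finite (cones_of F)" by simp
  next
    fix C assume "C \<in> cones_of F"
    then obtain S T where S: "T \<in> F" "S \<subseteq> T" "C = convex_cone hull S" by (auto simp: cones_of_def)
    show "rational_polyhedral_cone L C"
      unfolding rational_polyhedral_cone_def using S sub[OF S(1,2)] JL by blast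
    show "strongly_convex C"
      unfolding S(3) by (rule strongly_convex_orthant_cone) (use sub[OF S(1,2)] J in blast)
    fix G assume G: "G face_of C \<and> G \<noteq> {}"
    then have "G = convex_cone hull (S \<inter> G)"
      using face_of_finitely_generated_cone[OF sub(2)[OF S(1,2)]] S(3) by blast
    then show "G \<in> cones_of F" using mem[OF S(1), of "S \<inter> G"] S(2) by auto
  next
    fix C D assume "C \<in> cones_of F" "D \<in> cones_of F"
    then obtain S T S' T' where S: "T \<in> F" "S \<subseteq> T" "C = convex_cone hull S"
      and S': "T' \<in> F" "S' \<subseteq> T'" "D = convex_cone hull S'" by (auto simp: cones_of_def)
    have CD: "C \<inter> D = convex_cone hull (S \<inter> S')"
      unfolding S(3) S'(3) by (rule cones_of_intersection[OF tr S(1,2) S'(1,2)])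
    show "C \<inter> D face_of C"
      unfolding CD by (subst S(3), rule simplicial_cone_face) (use sub[OF S(1,2)] in auto)
    show "C \<inter> D face_of D"
      unfolding CD by (subst S'(3), rule simplicial_cone_face) (use sub[OF S'(1,2)] in auto)
  qed
  show "subdivides (cones_of F) positive_orthant" unfolding subdivides_def
  proof (intro equalityI subsetI)
    fix x assume "x \<in> \<Union>(cones_of F)"
    then obtain S T where S: "T \<in> F" "S \<subseteq> T" "x \<in> convex_cone hull S" by (auto simp: cones_of_def)
    have "convex_cone hull S \<subseteq> positive_orthant"
    proof (rule hull_minimal)
      show "S \<subseteq> positive_orthant" using sub[OF S(1,2)] J by blast
      show "convex_cone (positive_orthant :: (real^'n) set)"
        by (auto simp: convex_cone_iff positive_orthant_def)
    qed
    then show "x \<in> positive_orthant" using S by blast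
  next
    fix x :: "real^'n" assume "x \<in> positive_orthant"
    then obtain l where l: "cone_rep J F x l" using triangulatesD(5)[OF tr] by blast
    then obtain T where T: "T \<in> F" "\<And>u. l u \<noteq> 0 \<Longrightarrow> u \<in> T" by (auto simp: cone_rep_def)
    have "x = (\<Sum>u\<in>J. l u *\<^sub>R u)" and l0: "\<And>u. 0 \<le> l u" using l by (auto simp: cone_rep_def)
    then have "x = (\<Sum>u\<in>T. l u *\<^sub>R u)"
      using cone_rep_sum_facet[OF tr T] by simp
    then have "x \<in> convex_cone hull T"
      using convex_cone_hull_finiteI[of T l] sub[OF T(1) subset_refl] l0 by simp
    then show "x \<in> \<Union>(cones_of F)" using mem[OF T(1) subset_refl] by blast
  qed
qed

lemma unimodular_triangulation_crepant_resolution: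
  assumes tr: "triangulates (junior_points L) F positive_orthant"
    and basis: "\<And>T. T \<in> F \<Longrightarrow> lattice_basis L T"
  shows "crepant_resolution L (cones_of F)"
proof -
  have J: "junior_points L \<subseteq> L" "junior_points L \<subseteq> positive_orthant"
    by (auto simp: junior_points_def positive_orthant_def)
  have "smooth_fan L (cones_of F)"
    unfolding smooth_fan_def smooth_cone_def cones_of_def using basis by blast
  moreover have "crepant_fan L (cones_of F)" unfolding crepant_fan_def
  proof
    fix R assume "R \<in> rays (cones_of F)"
    then obtain S T where S: "T \<in> F" "S \<subseteq> T" "R = convex_cone hull S" and dim: "dim R = 1"
      by (auto simp: rays_def cones_of_def)
    have "independent S" using triangulates_independent[OF tr S(1)] S(2) independent_mono by blast
    then have "card S = 1" using dim dim_simplicial_cone S(3) by metis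
    then obtain s where s: "S = {s}" by (auto simp: card_1_singleton_iff)
    then have "s \<in> T" using S by simp
    then have "primitive_generator L R = s"
      using primitive_generator_basis_vector[OF basis[OF S(1)]] S s by simp
    moreover have "s \<in> junior_points L" using triangulatesD(2)[OF tr S(1)] \<open>s \<in> T\<close> by blast
    ultimately show "discrepancy L R = 0" by (simp add: discrepancy_def junior_points_def)
  qed
  ultimately show ?thesis
    unfolding crepant_resolution_def using cones_of_fan[OF tr J] by blast
qed

section \<open>Unimodular triangulations of the orthant\<close>

definition int_span :: "'a::real_vector set \<Rightarrow> 'a set" where
  "int_span B = {\<Sum>b\<in>B. of_int (k b) *\<^sub>R b | k. True}"

lemma int_spanI: "(\<Sum>b\<in>B. of_int (k b) *\<^sub>R b) \<in> int_span B"
  by (auto simp: int_span_def)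

lemma int_span_add: "x \<in> int_span B \<Longrightarrow> y \<in> int_span B \<Longrightarrow> x + y \<in> int_span B"
proof -
  assume "x \<in> int_span B" "y \<in> int_span B"
  then obtain k l where "x = (\<Sum>b\<in>B. of_int (k b) *\<^sub>R b)" "y = (\<Sum>b\<in>B. of_int (l b) *\<^sub>R b)"
    by (auto simp: int_span_def)
  then have "x + y = (\<Sum>b\<in>B. of_int (k b + l b) *\<^sub>R b)"
    by (simp add: scaleR_add_left sum.distrib)
  then show ?thesis using int_spanI[of "\<lambda>b. k b + l b" B] by simp
qed

lemma int_span_scale: "x \<in> int_span B \<Longrightarrow> of_int z *\<^sub>R x \<in> int_span B"
proof -
  assume "x \<in> int_span B"
  then obtain k where "x = (\<Sum>b\<in>B. of_int (k b) *\<^sub>R b)" by (auto simp: int_span_def)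
  then have "of_int z *\<^sub>R x = (\<Sum>b\<in>B. of_int (z * k b) *\<^sub>R b)" by (simp add: scaleR_sum_right)
  then show ?thesis using int_spanI[of "\<lambda>b. z * k b" B] by simp
qed

lemma int_span_sum: "(\<And>i. i \<in> A \<Longrightarrow> x i \<in> int_span B) \<Longrightarrow> (\<Sum>i\<in>A. x i) \<in> int_span B"
  using int_spanI[of "\<lambda>_. 0" B]
  by (induction A rule: infinite_finite_induct) (auto simp: int_span_add)

lemma int_span_base:
  assumes "finite B" "b \<in> B"
  shows "b \<in> int_span B"
  using int_spanI[of "\<lambda>x. if x = b then 1 else 0" B] assms
  by (simp add: if_distrib[of "\<lambda>x. of_int x *\<^sub>R _"] cong: if_cong)

lemma lattice_basis_iff: "lattice_basis L B \<longleftrightarrow> independent B \<and> L = int_span B"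
  by (simp add: lattice_basis_def int_span_def)

text \<open>
  The coefficients are nonnegative integers, and comparing ages shows that their sum is one.
\<close>

lemma age_one_point_in_basis_cone:
  fixes L :: "(real^'n::finite) set"
  assumes S: "lattice_basis L S" "\<And>u. u \<in> S \<Longrightarrow> age u = 1"
    and v: "v \<in> L" "age v = 1" and l: "\<And>u. 0 \<le> l u" "v = (\<Sum>u\<in>S. l u *\<^sub>R u)"
  shows "v \<in> S"
proof -
  have ind: "independent S" using S by (simp add: lattice_basis_def)
  have fin: "finite S" using ind by (rule finiteI_independent)
  have "v \<in> int_span S" using v S by (simp add: lattice_basis_iff)
  then obtain k where k: "v = (\<Sum>u\<in>S. of_int (k u) *\<^sub>R u)" by (auto simp: int_span_def)
  have kl: "of_int (k u) = l u" if "u \<in> S" for u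
    using independent_coefficients_eq[OF ind trans[OF k[symmetric] l(2)] that] .
  have "real_of_int (\<Sum>u\<in>S. k u) = (\<Sum>u\<in>S. of_int (k u) * age u)" using S(2) by simp
  also have "\<dots> = age v" unfolding k age_sum ..
  finally have "real_of_int (\<Sum>u\<in>S. k u) = 1" using v by simp
  then have sum: "(\<Sum>u\<in>S. k u) = 1" by (simp only: of_int_eq_1_iff)
  have nonneg: "0 \<le> k u" if "u \<in> S" for u
    using kl[OF that] l(1)[of u] by (metis of_int_0_le_iff)
  obtain u where u: "u \<in> S" "k u \<noteq> 0" using sum by (metis sum.neutral zero_neq_one)
  have rest: "(\<Sum>u\<in>S - {u}. k u) = 1 - k u" using sum sum.remove[OF fin u(1), of k] by simp
  moreover have "(\<Sum>u\<in>S - {u}. k u) \<ge> 0" using nonneg by (intro sum_nonneg) auto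
  ultimately have ku: "k u = 1" using nonneg[OF u(1)] u(2) by linarith
  then have "\<forall>w\<in>S - {u}. k w = 0"
    using rest nonneg fin sum_nonneg_eq_0_iff[of "S - {u}" k] by auto
  then have "v = u"
    unfolding k using sum.remove[OF fin u(1), of "\<lambda>u. of_int (k u) *\<^sub>R u"] ku by simp
  then show ?thesis using u by simp
qed

text \<open>
  If the support had one element, \<open>v\<close> would be a multiple of a vertex and, having the
  same age, equal to it.
\<close>

lemma triangulation_support_two:
  assumes tr: "triangulates J F X" and J: "\<And>u. u \<in> J \<Longrightarrow> age u = 1"
    and v: "v \<in> J" "v \<notin> \<Union>F" and a: "cone_rep J F v a"
  obtains u1 u2 where "u1 \<noteq> u2" "a u1 \<noteq> 0" "a u2 \<noteq> 0"
proof (rule ccontr)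
  assume no: "\<not> thesis"
  have "v \<noteq> 0" using J[OF v(1)] by (auto simp: age_def)
  then obtain w where w: "a w \<noteq> 0" using star_support_nonempty[OF tr v _ a] by blast
  have other: "a u = 0" if "u \<noteq> w" for u using no \<open>u \<noteq> w\<close> w \<open>\<And>u1 u2. u1 \<noteq> u2 \<Longrightarrow> a u1 \<noteq> 0 \<Longrightarrow> a u2 \<noteq> 0 \<Longrightarrow> thesis\<close> by blast
  obtain S where S: "S \<in> F" "\<And>u. a u \<noteq> 0 \<Longrightarrow> u \<in> S" using a by (auto simp: cone_rep_def)
  have wJ: "w \<in> J" using triangulatesD(2)[OF tr S(1)] S(2)[OF w] by blast
  have "v = (\<Sum>u\<in>J. a u *\<^sub>R u)" using a by (simp add: cone_rep_def)
  also have "\<dots> = (\<Sum>u\<in>J. (if u = w then a w else 0) *\<^sub>R u)"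
    by (intro sum.cong) (auto simp: other)
  also have "\<dots> = a w *\<^sub>R w" using triangulatesD(1)[OF tr] wJ
    by (simp add: if_distrib[of "\<lambda>x. x *\<^sub>R _"] cong: if_cong)
  finally have vw: "v = a w *\<^sub>R w" .
  then have "a w = 1" using J[OF v(1)] J[OF wJ] by (simp add: age_scaleR)
  then show False using vw v(2) S w by auto
qed

context two_coordinate_lattice
begin

abbreviation J where "J \<equiv> junior_points L"

definition E :: "(real^'n) set" where "E = (\<lambda>j. axis j 1) ` I"

lemma lattice_basisI:
  assumes "independent B" "B \<subseteq> L" "L \<subseteq> int_span B"
  shows "lattice_basis L B"
proof -
  have "int_span B \<subseteq> L"
    using assms(2) by (auto simp: int_span_def intro!: sum_in of_int_scale_in)
  then show ?thesis using assms by (simp add: lattice_basis_iff)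
qed

lemma axis_junior: "axis i 1 \<in> J"
proof -
  have "0 \<le> axis i (1::real) $ k" for k by (simp add: axis_def)
  then show ?thesis using axis_in by (simp add: junior_points_def age_axis)
qed

lemma Basis_eq: "(Basis :: (real^'n) set) = range (\<lambda>i. axis i 1)"
  by (auto simp: Basis_vec_def)

lemma E_properties: "finite E" "card E = m" "E \<subseteq> Basis" "axis p 1 \<notin> E" "tail_one = (\<Sum>u\<in>E. u)"
proof -
  have inj: "inj_on (\<lambda>j. axis j (1::real)) I" by (auto simp: inj_on_def axis_eq_axis)
  show "finite E" by (simp add: E_def)
  show "card E = m" unfolding E_def card_image[OF inj] by (rule card_I)
  show "E \<subseteq> Basis" by (auto simp: E_def Basis_eq)
  show "axis p 1 \<notin> E" by (auto simp: E_def axis_eq_axis)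
  show "tail_one = (\<Sum>u\<in>E. u)" unfolding E_def sum.reindex[OF inj] tail_eq_sum by simp
qed

lemma tail_in_int_span:
  assumes "finite B" "E \<subseteq> B"
  shows "tail k \<in> int_span B"
  unfolding tail_eq_sum
  by (intro int_span_sum int_span_scale int_span_base) (use assms in \<open>auto simp: E_def\<close>)

lemma vec_eqI_cases:
  fixes x y :: "real^'n"
  assumes "x $ p = y $ p" "x $ q = y $ q" "\<And>i. i \<in> I \<Longrightarrow> x $ i = y $ i"
  shows "x = y"
  unfolding vec_eq_iff using assms cases_I by metis

lemma axis_nth_cases [simp]:
  "axis p (1::real) $ p = 1" "axis p (1::real) $ q = 0" "axis q (1::real) $ p = 0" "axis q (1::real) $ q = 1"
  "i \<in> I \<Longrightarrow> axis p (1::real) $ i = 0" "i \<in> I \<Longrightarrow> axis q (1::real) $ i = 0"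
  using pq by (auto simp: axis_def)

context
  assumes finite_J: "finite J"
begin

lemma orthant_triangulates: "triangulates J {Basis} positive_orthant"
  unfolding triangulates_def
proof (intro conjI ballI allI impI)
  have BJ: "Basis \<subseteq> J" using axis_junior by (auto simp: Basis_eq)
  show "finite J" by (rule finite_J)
  show "S \<subseteq> J" "card S = DIM(real^'n)" if "S \<in> {Basis}" for S using that BJ by auto
  have restrict: "(\<Sum>u\<in>J. l u *\<^sub>R u) = (\<Sum>u\<in>Basis. l u *\<^sub>R u)"
    if "\<And>u. l u \<noteq> 0 \<Longrightarrow> u \<in> Basis" for l :: "real^'n \<Rightarrow> real"
  proof (rule sum.mono_neutral_right[OF finite_J BJ])
    have "l u = 0" if "u \<notin> Basis" for u using \<open>\<And>u. l u \<noteq> 0 \<Longrightarrow> u \<in> Basis\<close> that by blast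
    then show "\<forall>u\<in>J - Basis. l u *\<^sub>R u = 0" by simp
  qed
  show "\<exists>l. cone_rep J {Basis} x l" if x: "x \<in> positive_orthant" for x
  proof -
    define l where "l = (\<lambda>u. if u \<in> Basis then x \<bullet> u else 0)"
    have "(\<Sum>u\<in>Basis. l u *\<^sub>R u) = (\<Sum>u\<in>Basis. (x \<bullet> u) *\<^sub>R u)"
      by (intro sum.cong) (auto simp: l_def)
    then have "x = (\<Sum>u\<in>J. l u *\<^sub>R u)"
      using restrict[of l] euclidean_representation[of x] by (simp add: l_def split: if_splits)
    moreover have "0 \<le> l u" for u
      using x by (auto simp: l_def Basis_eq inner_axis positive_orthant_def)
    ultimately show ?thesis unfolding cone_rep_def by (intro exI[of _ l]) (auto simp: l_def)
  qed
  fix x l l' assume l: "cone_rep J {Basis} x l" and l': "cone_rep J {Basis} x l'"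
  have supp: "\<And>u. l u \<noteq> 0 \<Longrightarrow> u \<in> Basis" "\<And>u. l' u \<noteq> 0 \<Longrightarrow> u \<in> Basis"
    using l l' by (auto simp: cone_rep_def)
  have "x = (\<Sum>u\<in>Basis. l u *\<^sub>R u)" "x = (\<Sum>u\<in>Basis. l' u *\<^sub>R u)"
    using l l' restrict[OF supp(1)] restrict[OF supp(2)] by (simp_all add: cone_rep_def)
  then have "(\<Sum>u\<in>Basis. l u *\<^sub>R u) = (\<Sum>u\<in>Basis. l' u *\<^sub>R u)" by (rule trans[OF sym])
  note eq = independent_coefficients_eq[OF independent_Basis this]
  show "l = l'"
  proof
    fix u show "l u = l' u"
    proof (cases "u \<in> Basis")
      case False
      then have "l u = 0" "l' u = 0" using supp by blast+
      then show ?thesis by simp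
    qed (rule eq)
  qed
qed

text \<open>
  A cone over a lattice basis of junior points contains no junior points besides its generators, so
  a facet containing \<open>E\<close> is cut by a star subdivision at a new junior point only if it
  is not a lattice basis.
\<close>

lemma star_facet_containing_E:
  assumes tr: "triangulates J F positive_orthant" and EF: "E \<subseteq> \<Union>F"
    and v: "v \<in> J" "v \<notin> \<Union>F" and a: "cone_rep J F v a"
    and T: "T \<in> star_subdivision a v F" "E \<subseteq> T"
  obtains "T \<in> F" "\<not> {u. a u \<noteq> 0} \<subseteq> T"
  | S u where "S \<in> F" "E \<subseteq> S" "\<not> lattice_basis L S" "a u \<noteq> 0" "u \<notin> E" "T = insert v (S - {u})"
proof (cases "T \<in> F \<and> \<not> {u. a u \<noteq> 0} \<subseteq> T")
  case True
  then show ?thesis using that by blast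
next
  case False
  then obtain S u where S: "S \<in> F" "{u. a u \<noteq> 0} \<subseteq> S" "a u \<noteq> 0" "T = insert v (S - {u})"
    using T(1) unfolding star_subdivision_def by blast
  have "v \<notin> E" using v EF by blast
  then have E: "E \<subseteq> S" "u \<notin> E" using T(2) S(4) by auto
  have "\<not> lattice_basis L S"
  proof
    assume basis: "lattice_basis L S"
    have SJ: "S \<subseteq> J" by (rule triangulatesD(2)[OF tr S(1)])
    have "v = (\<Sum>u\<in>J. a u *\<^sub>R u)" and a0: "\<And>u. 0 \<le> a u" using a by (simp_all add: cone_rep_def)
    moreover have "(\<Sum>u\<in>J. a u *\<^sub>R u) = (\<Sum>u\<in>S. a u *\<^sub>R u)"
      using S(2) by (intro cone_rep_sum_facet[OF tr S(1)]) auto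
    ultimately have "v = (\<Sum>u\<in>S. a u *\<^sub>R u)" by simp
    moreover have "age u = 1" if "u \<in> S" for u using SJ that by (auto simp: junior_points_def)
    moreover have "v \<in> L" "age v = 1" using v by (auto simp: junior_points_def)
    ultimately have "v \<in> S" using a0 by (intro age_one_point_in_basis_cone[OF basis, of v a])
    then show False using v S by blast
  qed
  then show ?thesis using that(2)[OF S(1) E(1) _ S(3) E(2) S(4)] by blast
qed

lemma star_at_junior_point:
  assumes tr: "triangulates J F positive_orthant"
    and v: "v \<in> J" "v \<notin> \<Union>F" and a: "cone_rep J F v a"
  shows "triangulates J (star_subdivision a v F) positive_orthant"
    and "insert v (\<Union>F) \<subseteq> \<Union>(star_subdivision a v F)"
proof -
  have "v \<noteq> 0" using v(1) by (auto simp: junior_points_def age_def)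
  then show "triangulates J (star_subdivision a v F) positive_orthant"
    by (rule star_triangulates[OF tr v _ a])
  have "\<And>u. u \<in> J \<Longrightarrow> age u = 1" by (simp add: junior_points_def)
  then obtain u1 u2 where "u1 \<noteq> u2" "a u1 \<noteq> 0" "a u2 \<noteq> 0"
    using triangulation_support_two[OF tr _ v a] by blast
  then show "insert v (\<Union>F) \<subseteq> \<Union>(star_subdivision a v F)" by (rule star_vertices[OF _ _ _ a])
qed

text \<open>
  A facet \<open>{x, y} \<union> E\<close> is linearly independent because it belongs to a
  triangulation, so it is a lattice basis as soon as it generates two consecutive points of the
  chain.
\<close>

lemma two_vectors_and_tail_basis:
  assumes tr: "triangulates J F positive_orthant" and T: "insert x (insert y E) \<in> F"
    and gen: "a \<in> int_span (insert x (insert y E))" "b \<in> int_span (insert x (insert y E))"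
    and st: "chain_state a b d c"
  shows "lattice_basis L (insert x (insert y E))" (is "lattice_basis L ?B")
proof (rule lattice_basisI)
  show "independent ?B" by (rule triangulates_independent[OF tr T])
  have "?B \<subseteq> J" by (rule triangulatesD(2)[OF tr T])
  then show "?B \<subseteq> L" by (auto simp: junior_points_def)
  show "L \<subseteq> int_span ?B"
  proof
    fix z assume "z \<in> L"
    then obtain \<alpha> \<beta> k where "z = of_int \<alpha> *\<^sub>R a + of_int \<beta> *\<^sub>R b + tail k"
      using st unfolding chain_state_def by blast
    moreover have "tail k \<in> int_span ?B" using E_properties(1) by (intro tail_in_int_span) auto
    ultimately show "z \<in> int_span ?B" using gen by (simp add: int_span_add int_span_scale)
  qed
qed

text \<open>
  Invariant: among the facets that contain \<open>E\<close>, only \<open>{e\<^sub>p, a} \<union>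
  E\<close> may fail to be a lattice basis. Its star subdivision at the next point \<open>b\<close>
  of the chain yields \<open>{a, b} \<union> E\<close>, a lattice basis, and \<open>{e\<^sub>p, b}
  \<union> E\<close>, which is of the same kind with smaller index; all other new facets miss an
  element of \<open>E\<close>. The chain ends when \<open>b\<close> lies on the face without
  \<open>a\<close> (\<open>d = 0\<close>) or when \<open>{e\<^sub>p, b} \<union> E\<close> has index
  one (\<open>d = 1\<close>).
\<close>

lemma chain_triangulation:
  assumes "triangulates J F positive_orthant" "Basis \<subseteq> \<Union>F" "chain_state a b d c"
    and "insert (axis p 1) (insert a E) \<in> F" "1 + d + m * c \<ge> 2" "age_one_chain m d c"
    and "\<And>S. S \<in> F \<Longrightarrow> E \<subseteq> S \<Longrightarrow> S \<noteq> insert (axis p 1) (insert a E) \<Longrightarrow> lattice_basis L S"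
  shows "\<exists>F'. triangulates J F' positive_orthant \<and> Basis \<subseteq> \<Union>F' \<and> (\<forall>S\<in>F'. E \<subseteq> S \<longrightarrow> lattice_basis L S)"
  using assms
proof (induction d arbitrary: F a b c rule: less_induct)
  case (less d)
  note tr = less.prems(1) and st = less.prems(3) and S0 = less.prems(4)
  let ?e = "axis p 1 :: real^'n"
  let ?S = "insert ?e (insert a E)"
  define r where "r = real (1 + d + m * c)"
  have r: "r \<ge> 2" unfolding r_def using less.prems(5) by (metis of_nat_le_iff of_nat_numeral)
  have req: "r *\<^sub>R b = ?e + real d *\<^sub>R a + real c *\<^sub>R tail_one"
    using st by (simp add: chain_state_def r_def)
  have "card ?S = m + 2"
    using triangulatesD(4)[OF tr S0] card by (simp add: m_def)
  then have dist: "a \<noteq> ?e" "a \<notin> E" "?e \<notin> E"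
    using E_properties(1,2) card_insert_le_m1[of _ E] by (auto simp: card_insert_if split: if_splits)
  \<comment> \<open>The representation of \<open>b\<close> by the generators of the cone that it subdivides.\<close>
  define l where "l = (\<lambda>u. (if u = ?e then 1 / r else 0) + (if u = a then real d / r else 0)
      + (if u \<in> E then real c / r else 0))"
  have l_e: "l ?e = 1 / r" and l_a: "l a = real d / r" using dist by (auto simp: l_def)
  have l0: "0 \<le> l u" for u using r by (auto simp: l_def)
  have supp: "u \<in> ?S" if "l u \<noteq> 0" for u using that by (auto simp: l_def split: if_splits)
  have SJ: "?S \<subseteq> J" by (rule triangulatesD(2)[OF tr S0])
  have b_eq: "b = (\<Sum>u\<in>J. l u *\<^sub>R u)"
  proof -
    have "(\<Sum>u\<in>J. l u *\<^sub>R u) = (\<Sum>u\<in>?S. l u *\<^sub>R u)" by (rule cone_rep_sum_facet[OF tr S0 supp])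
    also have "\<dots> = l ?e *\<^sub>R ?e + (l a *\<^sub>R a + (\<Sum>u\<in>E. l u *\<^sub>R u))"
      using dist E_properties(1) by simp
    also have "(\<Sum>u\<in>E. l u *\<^sub>R u) = (\<Sum>u\<in>E. (real c / r) *\<^sub>R u)"
      using dist by (intro sum.cong) (auto simp: l_def)
    also have "\<dots> = (real c / r) *\<^sub>R tail_one" unfolding E_properties(5) by (simp add: scaleR_sum_right)
    also have "l ?e *\<^sub>R ?e + (l a *\<^sub>R a + \<dots>) = (1 / r) *\<^sub>R (r *\<^sub>R b)"
      unfolding req l_e l_a by (simp add: scaleR_add_right)
    also have "\<dots> = b" using r by simp
    finally show ?thesis by simp
  qed
  have rep: "cone_rep J F b l" unfolding cone_rep_def using S0 supp l0 b_eq by blast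
  have bJ: "b \<in> J" using st by (simp add: chain_state_def junior_points_def)
  have bF: "b \<notin> \<Union>F"
  proof
    assume "b \<in> \<Union>F"
    then have "l = (\<lambda>u. if u = b then 1 else 0)"
      using triangulatesD(6)[OF tr rep triangulates_vertex_rep[OF tr]] by blast
    from fun_cong[OF this, of ?e] show False using l_e r by (auto split: if_splits)
  qed
  have EF: "E \<subseteq> \<Union>F" using E_properties(3) less.prems(2) by blast
  let ?F = "star_subdivision l b F"
  note tr' = star_at_junior_point(1)[OF tr bJ bF rep]
  have Basis': "Basis \<subseteq> \<Union>?F" using star_at_junior_point(2)[OF tr bJ bF rep] less.prems(2) by blast
  have facet: "lattice_basis L T \<or> (T = insert ?e (insert b E) \<and> d > 0)" if T: "T \<in> ?F" "E \<subseteq> T" for T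
    using star_facet_containing_E[OF tr EF bJ bF rep T]
  proof cases
    case 1
    have "{u. l u \<noteq> 0} \<subseteq> ?S" using supp by blast
    then have "T \<noteq> ?S" using 1 by blast
    then show ?thesis using less.prems(7) 1 T by blast
  next
    case (2 S u)
    then have S: "S = ?S" using less.prems(7) by blast
    then have "u = ?e \<or> u = a" using supp[OF 2(4)] 2(5) by blast
    then show ?thesis
    proof
      assume "u = ?e"
      then have T_eq: "T = insert b (insert a E)" using 2(6) S dist by auto
      have "lattice_basis L (insert b (insert a E))"
        by (rule two_vectors_and_tail_basis[OF tr' _ _ _ st])
          (use T T_eq E_properties(1) in \<open>auto intro: int_span_base\<close>)
      then show ?thesis using T_eq by simp
    next
      assume u: "u = a"
      then have "T = insert ?e (insert b E)" using 2(6) S dist by auto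
      moreover have "d > 0" using 2(4) u l_a by (auto intro: ccontr)
      ultimately show ?thesis by simp
    qed
  qed
  have next_facet: "insert ?e (insert b E) \<in> ?F" if "d > 0"
  proof -
    have "{u. l u \<noteq> 0} \<subseteq> ?S" using supp by blast
    moreover have "l a \<noteq> 0" using l_a r that by simp
    ultimately have "insert b (?S - {a}) \<in> ?F"
      unfolding star_subdivision_def using S0 by blast
    moreover have "insert b (?S - {a}) = insert ?e (insert b E)" using dist by auto
    ultimately show ?thesis by simp
  qed
  consider "d = 0" | "d = 1" | "d \<ge> 2" by linarith
  then show ?case
  proof cases
    case 1
    then show ?thesis using tr' Basis' facet by blast
  next
    case 2
    let ?B = "insert ?e (insert b E)"
    have fin: "finite ?B" using E_properties(1) by simp
    have "a = of_int (int (1 + d + m * c)) *\<^sub>R b + (of_int (-1) *\<^sub>R ?e + of_int (- int c) *\<^sub>R tail_one)"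
      using req 2 by (simp add: r_def algebra_simps)
    also have "\<dots> \<in> int_span ?B"
      by (intro int_span_add int_span_scale int_span_base tail_in_int_span) (use fin in auto)
    finally have a: "a \<in> int_span ?B" .
    have "lattice_basis L ?B"
      by (rule two_vectors_and_tail_basis[OF tr' _ a _ st])
        (use next_facet 2 fin in \<open>auto intro: int_span_base\<close>)
    then show ?thesis using tr' Basis' facet by blast
  next
    case 3
    define e where "e = c mod d"
    define s where "s = d - 1 - m * e"
    have le: "m * e + 1 \<le> d" and chain: "age_one_chain m s e"
      using less.prems(6) 3 unfolding e_def s_def by (auto simp: age_one_chain.simps[of m d c] split: if_splits)
    have gs: "1 + s + m * (c mod d) = 1 * d" using le by (simp add: s_def e_def)
    have sd: "s < d" using 3 by (simp add: s_def)
    from next_state[OF st 3 gs refl] obtain P where "chain_state b P s e" by (auto simp: e_def)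
    moreover have "1 + s + m * e \<ge> 2" using gs 3 by (simp add: e_def)
    moreover have "insert ?e (insert b E) \<in> ?F" using next_facet 3 by simp
    ultimately show ?thesis using less.IH[OF sd tr' Basis' _ _ _ chain] facet by blast
  qed
qed

text \<open>
  Subdivision at a junior point that is not yet a vertex does not affect the facets that contain
  \<open>E\<close>, as these are lattice bases.
\<close>

lemma full_triangulation:
  assumes "triangulates J F positive_orthant" "Basis \<subseteq> \<Union>F" "\<And>S. S \<in> F \<Longrightarrow> E \<subseteq> S \<Longrightarrow> lattice_basis L S"
  shows "\<exists>F'. triangulates J F' positive_orthant \<and> J \<subseteq> \<Union>F' \<and> (\<forall>S\<in>F'. E \<subseteq> S \<longrightarrow> lattice_basis L S)"
  using assms
proof (induction "card (J - \<Union>F)" arbitrary: F rule: less_induct)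
  case less
  note tr = less.prems(1)
  show ?case
  proof (cases "J \<subseteq> \<Union>F")
    case True
    then show ?thesis using less.prems by blast
  next
    case False
    then obtain v where v: "v \<in> J" "v \<notin> \<Union>F" by blast
    then have "v \<in> positive_orthant" by (simp add: junior_points_def positive_orthant_def)
    then obtain l where l: "cone_rep J F v l" using triangulatesD(5)[OF tr] by blast
    have EF: "E \<subseteq> \<Union>F" using E_properties(3) less.prems(2) by blast
    let ?F = "star_subdivision l v F"
    note star = star_at_junior_point[OF tr v l]
    have "card (J - \<Union>?F) < card (J - \<Union>F)"
      by (rule psubset_card_mono) (use finite_J star(2) v in auto)
    moreover have "Basis \<subseteq> \<Union>?F" using star(2) less.prems(2) by blast
    moreover have "lattice_basis L T" if T: "T \<in> ?F" "E \<subseteq> T" for T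
      using star_facet_containing_E[OF tr EF v l T]
    proof cases
      case 1
      then show ?thesis using less.prems(3) T by blast
    next
      case (2 S u)
      then show ?thesis using less.prems(3) by blast
    qed
    ultimately show ?thesis using less.hyps[OF _ star(1)] by blast
  qed
qed

lemma V_subset_span: "V \<subseteq> span {axis p 1, axis q 1, tail_one}"
proof
  fix x assume x: "x \<in> V"
  obtain j where j: "j \<in> I" using I_nonempty by blast
  have "x = x $ p *\<^sub>R axis p 1 + x $ q *\<^sub>R axis q 1 + x $ j *\<^sub>R tail_one"
  proof (rule vec_eqI_cases)
    fix i assume i: "i \<in> I"
    then have "x $ i = x $ j" using V_nth_eq[OF x] j by blast
    then show "x $ i = (x $ p *\<^sub>R axis p 1 + x $ q *\<^sub>R axis q 1 + x $ j *\<^sub>R tail_one) $ i"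
      using i by simp
  qed simp_all
  also have "\<dots> \<in> span {axis p 1, axis q 1, tail_one}"
    by (intro span_add span_scale span_base) auto
  finally show "x \<in> span {axis p 1, axis q 1, tail_one}" .
qed

text \<open>
  Counting dimensions, \<open>S\<close> has exactly three generators outside \<open>E\<close>, which
  lie in \<open>V\<close>, and misses some axis \<open>j0\<close>. Reduce a lattice point modulo
  \<open>S\<close> to coefficients in \<open>[0, 1)\<close>. Comparison of a coordinate in
  \<open>I\<close> with the coordinate \<open>j0\<close> shows that the coefficients on
  \<open>E\<close> are integers, hence zero. The age of the reduced point \<open>y\<close> is then
  \<open>0\<close>, \<open>1\<close> or \<open>2\<close>. Age one is impossible because
  \<open>y\<close> would be a vertex, and age two because the sum of the three generators minus
  \<open>y\<close> would be a vertex.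
\<close>

lemma short_facet_basis:
  assumes tr: "triangulates J F positive_orthant" and JF: "J \<subseteq> \<Union>F" and S: "S \<in> F" "\<not> E \<subseteq> S"
  shows "lattice_basis L S"
proof (rule lattice_basisI)
  show ind: "independent S" by (rule triangulates_independent[OF tr S(1)])
  have SJ: "S \<subseteq> J" by (rule triangulatesD(2)[OF tr S(1)])
  then show SL: "S \<subseteq> L" by (auto simp: junior_points_def)
  have fin: "finite S" by (rule triangulatesD(3)[OF tr S(1)])
  have card_S: "card S = m + 2" using triangulatesD(4)[OF tr S(1)] card by (simp add: m_def)
  let ?R = "S - E"
  have RV: "?R \<subseteq> V"
  proof
    fix u assume u: "u \<in> ?R"
    then have "u \<in> J" using SJ by blast
    then show "u \<in> V" using u by (cases rule: junior_point_cases) (auto simp: E_def)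
  qed
  have "card ?R \<le> card {axis p 1, axis q 1, tail_one}"
    using independent_span_bound[of "{axis p 1, axis q 1, tail_one}" ?R] RV V_subset_span
      independent_mono[OF ind, of ?R] by blast
  also have "\<dots> \<le> 3" by (simp add: card_insert_if)
  finally have "card ?R \<le> 3" .
  moreover have "card (S \<inter> E) < m"
    using psubset_card_mono[of E "S \<inter> E"] E_properties(1,2) S(2) by auto
  moreover have "card S = card ?R + card (S \<inter> E)"
    using card_Diff_subset_Int[of S E] card_mono[OF fin, of "S \<inter> E"] fin by simp
  ultimately have card_R: "card ?R = 3" using card_S by simp
  have finR: "finite ?R" using fin by simp
  obtain j0 where j0: "j0 \<in> I" "axis j0 1 \<notin> S" using S(2) by (auto simp: E_def)
  show "L \<subseteq> int_span S"
  proof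
    fix x assume x: "x \<in> L"
    have "UNIV \<subseteq> span S"
      by (rule card_ge_dim_independent) (use ind card_S card in \<open>auto simp: m_def\<close>)
    then have "x \<in> range (\<lambda>u. \<Sum>v\<in>S. u v *\<^sub>R v)" using span_finite[OF fin] by auto
    then obtain h where h: "x = (\<Sum>u\<in>S. h u *\<^sub>R u)" by blast
    define f where "f = (\<lambda>u. frac (h u))"
    have f01: "0 \<le> f u" "f u < 1" for u by (simp_all add: f_def frac_lt_1)
    define y where "y = (\<Sum>u\<in>S. f u *\<^sub>R u)"
    have x_eq: "x = (\<Sum>u\<in>S. of_int \<lfloor>h u\<rfloor> *\<^sub>R u) + y"
      unfolding h y_def f_def frac_def by (simp add: scaleR_diff_left sum_subtractf)
    have floor_in: "(\<Sum>u\<in>S. of_int \<lfloor>h u\<rfloor> *\<^sub>R u) \<in> L"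
      using SL by (intro sum_in of_int_scale_in) blast
    have "y = x - (\<Sum>u\<in>S. of_int \<lfloor>h u\<rfloor> *\<^sub>R u)" using x_eq by simp
    then have yL: "y \<in> L" using diff_in[OF x floor_in] by simp
    have f_tail: "f u = 0" if u: "u \<in> S" "u \<in> E" for u
    proof -
      obtain j where j: "j \<in> I" "u = axis j 1" using u by (auto simp: E_def)
      have "y $ j - y $ j0 = (\<Sum>w\<in>S. f w * (w $ j - w $ j0))"
        by (simp add: y_def sum_component sum_subtractf right_diff_distrib)
      also have "\<dots> = (\<Sum>w\<in>S. if w = u then f u else 0)"
      proof (rule sum.cong)
        fix w assume w: "w \<in> S"
        then have "w \<in> J" using SJ by blast
        then show "f w * (w $ j - w $ j0) = (if w = u then f u else 0)"
        proof (cases rule: junior_point_cases)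
          case 1
          then have "w $ j = w $ j0" using V_nth_eq j(1) j0(1) by blast
          moreover have "w \<noteq> u" using \<open>w $ j = w $ j0\<close> j j0 u by (auto simp: axis_def split: if_splits)
          ultimately show ?thesis by simp
        next
          case (2 k)
          then have "k \<noteq> j0" "j \<noteq> j0" using w j0 u j by auto
          then show ?thesis using 2 j by (auto simp: axis_eq_axis) (auto simp: axis_def)
        qed
      qed simp
      also have "\<dots> = f u" using fin u by simp
      finally have "f u \<in> \<int>" using tail_diff_Ints[OF yL, of j j0] j j0 by (auto simp: I_def)
      then obtain z where z: "f u = of_int z" by (auto elim: Ints_cases)
      then have "0 \<le> z" "z < 1" using f01[of u] by simp_all
      then show ?thesis using z by simp
    qed
    have y_R: "y = (\<Sum>u\<in>?R. f u *\<^sub>R u)"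
      unfolding y_def by (rule sum.mono_neutral_right) (use fin f_tail in auto)
    have age_R: "age u = 1" if "u \<in> ?R" for u using that SJ by (auto simp: junior_points_def)
    have nonneg_R: "0 \<le> u $ i" if "u \<in> ?R" for u i using that SJ by (auto simp: junior_points_def)
    have age_y: "age y = (\<Sum>u\<in>?R. f u)" unfolding y_R age_sum using age_R by simp
    obtain z where z: "age y = of_int z" using age_Ints[OF yL] by (auto elim: Ints_cases)
    have "?R \<noteq> {}" using card_R by (metis card.empty zero_neq_numeral)
    then have "(\<Sum>u\<in>?R. f u) < (\<Sum>u\<in>?R. 1)"
      using finR f01 by (intro sum_strict_mono) auto
    then have "real_of_int z < 3" using z age_y card_R by simp
    moreover have "0 \<le> real_of_int z" using z age_y f01 by (metis sum_nonneg)
    ultimately have "z = 0 \<or> z = 1 \<or> z = 2" by linarith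
    \<comment> \<open>A junior point that is a nonnegative combination of the remaining generators is a vertex,
      hence one of them.\<close>
    have vertex: "g = (\<lambda>u. if u = w then 1 else 0)"
      if g: "\<And>u. u \<in> ?R \<Longrightarrow> 0 \<le> g' u" "w = (\<Sum>u\<in>?R. g' u *\<^sub>R u)" "w \<in> L" "age w = 1"
        "g = (\<lambda>u. if u \<in> ?R then g' u else 0)" for g g' w
    proof -
      have "0 \<le> w $ i" for i
        unfolding g(2) using g(1) nonneg_R by (auto simp: sum_component intro!: sum_nonneg)
      then have "w \<in> \<Union>F" using g JF by (auto simp: junior_points_def)
      from triangulates_vertex_rep[OF tr this] cone_rep_sum[OF tr S(1), of ?R g'] g
      show ?thesis by (intro triangulatesD(6)[OF tr, of w]) auto
    qed
    have "z = 0"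
    proof (rule ccontr)
      assume "z \<noteq> 0"
      then consider "z = 1" | "z = 2" using \<open>z = 0 \<or> z = 1 \<or> z = 2\<close> by blast
      then show False
      proof cases
        case 1
        have "(\<lambda>u. if u \<in> ?R then f u else 0) = (\<lambda>u. if u = y then 1 else 0)"
          by (rule vertex[OF _ y_R yL _ refl]) (use f01 z 1 in auto)
        from fun_cong[OF this, of y] show False using f01[of y] by (auto split: if_splits)
      next
        case 2
        define w where "w = (\<Sum>u\<in>?R. (1 - f u) *\<^sub>R u)"
        have "w = (\<Sum>u\<in>?R. u) - y"
          unfolding w_def y_R by (simp add: scaleR_diff_left sum_subtractf)
        moreover have "(\<Sum>u\<in>?R. u) \<in> L" using SL by (intro sum_in) blast
        ultimately have wL: "w \<in> L" using diff_in yL by simp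
        have "age w = (\<Sum>u\<in>?R. 1 - f u)" unfolding w_def age_sum using age_R by simp
        also have "\<dots> = 3 - age y" using card_R age_y by (simp add: sum_subtractf)
        finally have "age w = 1" using z 2 by simp
        then have eq: "(\<lambda>u. if u \<in> ?R then 1 - f u else 0) = (\<lambda>u. if u = w then 1 else 0)"
          by (intro vertex[OF _ w_def wL _ refl]) (use f01 in \<open>auto simp: less_imp_le\<close>)
        have "u = w" if "u \<in> ?R" for u
          using fun_cong[OF eq, of u] that f01[of u] by (auto split: if_splits)
        then have "?R \<subseteq> {w}" by blast
        then have "card ?R \<le> card {w}" by (intro card_mono) auto
        then show False using card_R by simp
      qed
    qed
    then have "(\<Sum>u\<in>?R. f u) = 0" using z age_y by simp
    then have "f u = 0" if "u \<in> ?R" for u using sum_nonneg_eq_0_iff[OF finR] f01 that by blast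
    then have "y = 0" unfolding y_R by simp
    then show "x \<in> int_span S" using x_eq int_spanI[of "\<lambda>u. \<lfloor>h u\<rfloor>" S] by simp
  qed
qed

lemma chain_crepant_resolution:
  assumes st: "chain_state (axis q 1) b d c" and r: "1 + d + m * c \<ge> 2" and chain: "age_one_chain m d c"
  shows "\<exists>\<Sigma>. crepant_resolution L \<Sigma>"
proof -
  have "range (\<lambda>i. axis i (1::real)) = (\<lambda>i. axis i 1) ` insert p (insert q I)"
    by (auto simp: I_def)
  then have B: "insert (axis p 1) (insert (axis q 1) E) = (Basis :: (real^'n) set)"
    by (simp add: Basis_eq E_def)
  obtain F where F: "triangulates J F positive_orthant" "Basis \<subseteq> \<Union>F"
    "\<And>S. S \<in> F \<Longrightarrow> E \<subseteq> S \<Longrightarrow> lattice_basis L S"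
    using chain_triangulation[OF orthant_triangulates _ st _ r chain] B by auto
  obtain F' where F': "triangulates J F' positive_orthant" "J \<subseteq> \<Union>F'"
    "\<And>S. S \<in> F' \<Longrightarrow> E \<subseteq> S \<Longrightarrow> lattice_basis L S"
    using full_triangulation[OF F] by blast
  have "lattice_basis L S" if "S \<in> F'" for S
    using short_facet_basis[OF F'(1,2) that] F'(3)[OF that] by blast
  then show ?thesis using unimodular_triangulation_crepant_resolution[OF F'(1)] by blast
qed

end

text \<open>
  The chain starts at \<open>e\<^sub>q\<close>, whose \<open>p\<close>-coordinate is zero, so the
  bounds required by \<open>chain_forced\<close> hold.
\<close>

lemma crepant_resolution_chain:
  assumes cr: "crepant_resolution L \<Sigma>" and st: "chain_state (axis q 1) b d c"
  shows "age_one_chain m d c"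
proof (rule chain_forced[OF _ st])
  fix x assume x: "x \<in> L" "\<And>i. 0 \<le> x $ i"
  obtain S k where "finite S" "S \<subseteq> junior_points L" "x = (\<Sum>u\<in>S. of_nat (k u) *\<^sub>R u)"
    by (rule crepant_resolution_decomposition[OF cr x])
  then show "\<exists>S k. finite S \<and> S \<subseteq> junior_points L \<and> x = (\<Sum>u\<in>S. of_nat (k u) *\<^sub>R u)"
    by (intro exI[of _ S] exI[of _ k]) simp
qed (use pq in \<open>auto simp: axis_def\<close>)

end

section \<open>The lattice of a cyclic quotient singularity\<close>

definition cyclic_lattice :: "nat \<Rightarrow> ('n::finite \<Rightarrow> nat) \<Rightarrow> (real^'n) set" where
  "cyclic_lattice r a = {z + of_int k *\<^sub>R (\<chi> i. real (a i) / real r) | z k. \<forall>i. z $ i \<in> \<int>}"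

lemma cyclic_latticeE:
  assumes "x \<in> cyclic_lattice r a"
  obtains z k where "x = (\<chi> i. of_int (z i) + of_int k * (real (a i) / real r))"
proof -
  obtain w k where w: "x = w + of_int k *\<^sub>R (\<chi> i. real (a i) / real r)" "\<And>i. w $ i \<in> \<int>"
    using assms by (auto simp: cyclic_lattice_def)
  then have "x = (\<chi> i. of_int \<lfloor>w $ i\<rfloor> + of_int k * (real (a i) / real r))"
    by (auto simp: vec_eq_iff)
  then show ?thesis by (rule that)
qed

lemma cyclic_latticeI:
  "(\<chi> i. of_int (z i) + of_int k * (real (a i) / real r)) \<in> cyclic_lattice r a"
  unfolding cyclic_lattice_def
  by (intro CollectI exI[of _ "\<chi> i. of_int (z i)"] exI[of _ k]) (auto simp: vec_eq_iff)

text \<open>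
  The coordinates of a junior point are multiples of \<open>1/r\<close> in \<open>[0, 1]\<close>.
\<close>

lemma finite_junior_points_cyclic_lattice:
  fixes a :: "'n::finite \<Rightarrow> nat"
  assumes "r > 0"
  shows "finite (junior_points (cyclic_lattice r a))"
proof (rule finite_subset)
  let ?G = "PiE UNIV (\<lambda>_. {..r}) :: ('n \<Rightarrow> nat) set"
  show "finite ((\<lambda>g. \<chi> i. real (g i) / real r) ` ?G)" by (intro finite_imageI finite_PiE) auto
  show "junior_points (cyclic_lattice r a) \<subseteq> (\<lambda>g. \<chi> i. real (g i) / real r) ` ?G"
  proof
    fix u assume u: "u \<in> junior_points (cyclic_lattice r a)"
    then obtain z k where zk: "u = (\<chi> i. of_int (z i) + of_int k * (real (a i) / real r))"
      by (auto simp: junior_points_def elim: cyclic_latticeE)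
    define h where "h = (\<lambda>i. z i * int r + k * int (a i))"
    have h: "u $ i = of_int (h i) / real r" for i using assms by (simp add: zk h_def field_simps)
    have u01: "0 \<le> u $ i" "u $ i \<le> 1" for i
    proof -
      show "0 \<le> u $ i" using u by (simp add: junior_points_def)
      have "u $ i \<le> (\<Sum>j\<in>UNIV. u $ j)"
        by (rule member_le_sum) (use u in \<open>auto simp: junior_points_def\<close>)
      then show "u $ i \<le> 1" using u by (simp add: junior_points_def age_def)
    qed
    have "0 \<le> h i" "h i \<le> int r" for i
      using u01[of i] assms unfolding h by (simp_all add: zero_le_divide_iff divide_le_eq_1)
    then have "u = (\<chi> i. real (nat (h i)) / real r)" "(\<lambda>i. nat (h i)) \<in> ?G"
      by (auto simp: vec_eq_iff h nat_le_iff)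
    then show "u \<in> (\<lambda>g. \<chi> i. real (g i) / real r) ` ?G" by (rule image_eqI)
  qed
qed

context
  fixes p q :: "'n::finite" and r d c :: nat
  assumes card: "CARD('n) \<ge> 3" and pq: "p \<noteq> q" and r: "1 + d + (CARD('n) - 2) * c = r"
begin

lemma weights_two_coordinate_lattice: "two_coordinate_lattice p q (cyclic_lattice r (weights p q d c))"
proof
  let ?a = "weights p q d c"
  have rpos: "r > 0" using r by simp
  show "CARD('n) \<ge> 3" "p \<noteq> q" by (fact card, fact pq)
  show "x - y \<in> cyclic_lattice r ?a" if xy: "x \<in> cyclic_lattice r ?a" "y \<in> cyclic_lattice r ?a" for x y
  proof -
    obtain z k where x: "x = (\<chi> i. of_int (z i) + of_int k * (real (?a i) / real r))"
      using xy(1) by (rule cyclic_latticeE)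
    obtain w l where y: "y = (\<chi> i. of_int (w i) + of_int l * (real (?a i) / real r))"
      using xy(2) by (rule cyclic_latticeE)
    have "x - y = (\<chi> i. of_int (z i - w i) + of_int (k - l) * (real (?a i) / real r))"
      by (simp add: x y vec_eq_iff algebra_simps diff_divide_distrib)
    then show ?thesis using cyclic_latticeI[of "\<lambda>i. z i - w i" "k - l" ?a r] by simp
  qed
  show "axis i 1 \<in> cyclic_lattice r ?a" for i
  proof -
    have "axis i 1 = (\<chi> j. of_int (if j = i then 1 else 0) + of_int 0 * (real (?a j) / real r))"
      by (auto simp: axis_def vec_eq_iff)
    then show ?thesis using cyclic_latticeI[of "\<lambda>j. if j = i then 1 else 0" 0 ?a r] by simp
  qed
  fix x assume "x \<in> cyclic_lattice r ?a"
  then obtain z k where x: "x = (\<chi> i. of_int (z i) + of_int k * (real (?a i) / real r))"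
    by (rule cyclic_latticeE)
  have "(\<Sum>i\<in>UNIV. real (?a i) / real r) = real (\<Sum>i\<in>UNIV. ?a i) / real r"
    by (simp add: sum_divide_distrib)
  also have "\<dots> = 1" using sum_weights[OF pq, of d c] r rpos by simp
  finally have weights_age: "(\<Sum>i\<in>UNIV. real (?a i) / real r) = 1" .
  have "age x = (\<Sum>i\<in>UNIV. of_int (z i)) + of_int k * (\<Sum>i\<in>UNIV. real (?a i) / real r)"
    by (simp add: age_def x sum.distrib sum_distrib_left)
  then have "age x = of_int ((\<Sum>i\<in>UNIV. z i) + k)" unfolding weights_age by simp
  then show "age x \<in> \<int>" by (simp only: Ints_of_int)
  fix i j assume "i \<notin> {p, q}" "j \<notin> {p, q}"
  then have "x $ i - x $ j = of_int (z i - z j)" by (simp add: x weights_def)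
  then show "x $ i - x $ j \<in> \<int>" by (simp only: Ints_of_int)
qed

interpretation two_coordinate_lattice p q "cyclic_lattice r (weights p q d c)"
  by (rule weights_two_coordinate_lattice)

lemma weights_chain_state:
  "chain_state (axis q 1) (\<chi> i. real (weights p q d c i) / real r) d c"
proof -
  let ?a = "weights p q d c" and ?b = "(\<chi> i. real (weights p q d c i) / real r) :: real^'n"
  have rm: "r = 1 + d + m * c" using r by (simp add: m_def)
  then have rpos: "real r > 0" by (metis of_nat_0_less_iff add_gr_0 zero_less_one)
  have a: "?a p = 1" "?a q = d" "\<And>i. i \<in> I \<Longrightarrow> ?a i = c"
    using pq by (auto simp: weights_def I_def)
  have req: "real r *\<^sub>R ?b = axis p 1 + real d *\<^sub>R axis q 1 + real c *\<^sub>R tail_one"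
  proof -
    show ?thesis using a rpos by (intro vec_eqI_cases) simp_all
  qed
  have bL: "?b \<in> cyclic_lattice r ?a" using cyclic_latticeI[of "\<lambda>_. 0" 1 ?a r] by simp
  have "real r * age ?b = real r"
    using arg_cong[OF req, of age] rm by (simp add: age_add age_scaleR age_axis age_tail_one)
  then have age_b: "age ?b = 1" using rpos by simp
  have gen: "\<exists>\<alpha> \<beta> k. x = of_int \<alpha> *\<^sub>R axis q 1 + of_int \<beta> *\<^sub>R ?b + tail k"
    if xL: "x \<in> cyclic_lattice r ?a" for x
  proof -
    obtain z k where x: "x = (\<chi> i. of_int (z i) + of_int k * (real (?a i) / real r))"
      using xL by (rule cyclic_latticeE)
    have "x = of_int (z q - z p * int d) *\<^sub>R axis q 1 + of_int (k + z p * int r) *\<^sub>R ?b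
        + tail (\<lambda>i. z i - int c * z p)"
      using a rpos by (intro vec_eqI_cases) (simp_all add: x field_simps)
    then show ?thesis by blast
  qed
  have "axis q 1 \<in> V" "?b \<in> V" using a not_in_I by (auto simp: V_def axis_def)
  moreover have "0 \<le> axis q (1::real) $ i" "0 \<le> ?b $ i" for i by (simp_all add: axis_def)
  ultimately show ?thesis
    using axis_in[of q] bL gen age_b req unfolding chain_state_def rm[symmetric] age_axis by blast
qed

lemma crepant_resolution_iff_chain:
  "(\<exists>\<Sigma>. crepant_resolution (cyclic_lattice r (weights p q d c)) \<Sigma>) \<longleftrightarrow>
    age_one_chain (CARD('n) - 2) d c" if "r \<ge> 2"
proof
  assume "\<exists>\<Sigma>. crepant_resolution (cyclic_lattice r (weights p q d c)) \<Sigma>"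
  then show "age_one_chain (CARD('n) - 2) d c"
    using crepant_resolution_chain[OF _ weights_chain_state] by (auto simp: m_def)
next
  assume chain: "age_one_chain (CARD('n) - 2) d c"
  have "finite (junior_points (cyclic_lattice r (weights p q d c)))"
    using r by (intro finite_junior_points_cyclic_lattice) simp
  moreover have "1 + d + m * c \<ge> 2" using that r by (simp add: m_def)
  ultimately show "\<exists>\<Sigma>. crepant_resolution (cyclic_lattice r (weights p q d c)) \<Sigma>"
    using chain_crepant_resolution[OF _ weights_chain_state] chain by (simp add: m_def)
qed

end

theorem theorem3p5:
  fixes p q :: "'n::finite" and r d c :: nat and \<epsilon> :: complex
  assumes "CARD('n) \<ge> 3"
    and "r \<ge> 2"
    and "p \<noteq> q"
    and "1 + d + (CARD('n) - 2) * c = r"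
    and "primitive_root_of_unity r \<epsilon>"
  shows "has_crepant_resolution (cyclic_group \<epsilon> (weights p q d c)) \<longleftrightarrow>
    (\<forall>f \<in> coefficients (remainder_polynomial (weight_fraction (weights p q d c) r)). frac_age f = 1)"
proof -
  let ?a = "weights p q d c"
  have sum: "(\<Sum>i\<in>UNIV. ?a i) = r" using sum_weights[OF assms(3)] assms(4) by simp
  have lattice: "quotient_lattice (cyclic_group \<epsilon> ?a) = cyclic_lattice r ?a"
    using quotient_lattice_cyclic_group[OF _ assms(5) sum] assms(2) by (simp add: cyclic_lattice_def)
  have "weight_fraction ?a r \<noteq> (\<lambda>_. 0, 1)" using assms(2) by (auto simp: weight_fraction_def)
  then have "(\<forall>f\<in>coefficients (remainder_polynomial (weight_fraction ?a r)). frac_age f = 1)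
      \<longleftrightarrow> descendants_age_one (Some (weight_fraction ?a r))"
    by (rule coefficients_age_one_iff)
  also have "\<dots> \<longleftrightarrow> age_one_chain (CARD('n) - 2) d c"
    using assms by (intro descendants_age_one_iff_chain) auto
  also have "\<dots> \<longleftrightarrow> has_crepant_resolution (cyclic_group \<epsilon> ?a)"
    unfolding has_crepant_resolution_def lattice
    using crepant_resolution_iff_chain[OF assms(1,3,4,2)] by simp
  finally show ?thesis by simp
qed

end
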